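(* For any left canonical matrix $V$ for $T$ at $\lambda_0$ there exists a right canonical matrix $Y$ for $T$ at $\lambda_0$ satisfying the biorthogonality condition $\Delta^{-1}VTY\Delta^{-1}\doteq\Delta^{-1}$. Such a right canonical matrix is determined uniquely up to addition of a matrix of the form $H\Delta$ with $H\in\mathcal{H}^{n\times r}$. For any right canonical $Y$ satisfying the biorthogonality condition with $V$, one has $T^{-1}\doteq Y\Delta^{-1}V$.
   Context: Let $\Omega\subset\mathbb{C}$ be open and $\lambda_0\in\Omega$ fixed. $\mathcal{H}$ denotes the ring of holomorphic functions on $\Omega$, and $\mathcal{H}_0$ the ring of functions holomorphic in some neighborhood of $\lambda_0$. Write $\chi_0(\lambda)=\lambda-\lambda_0$. A matrix $M\in\mathcal{H}_0^{n\times n}$ is unimodular if it has an inverse in $\mathcal{H}_0^{n\times n}$. For meromorphic matrices $M_1,M_2$ of equal size, $M_1\doteq M_2$ means that $M_2-M_1$ is holomorphic in a neighborhood of $\lambda_0$. Throughout, $T\in\mathcal{H}^{n\times n}$ with $\det T$ not identically zero and $\det T(\lambda_0)=0$, and $r=\dim\ker T(\lambda_0)$. There exist unimodular $U_L,U_R\in\mathcal{H}_0^{n\times n}$ and uniquely determined integers $m_1\ge\cdots\ge m_n\ge 0$ (the partial multiplicities) with $U_LTU_R=\mathrm{diag}(\chi_0^{m_1},\dots,\chi_0^{m_n})$; $m_i>0$ exactly for $i\le r$. Set $\Delta=\mathrm{diag}(\chi_0^{m_1},\dots,\chi_0^{m_r})$. A root function for $T$ at $\lambda_0$ is $y\in\mathcal{H}^n$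 with $y(\lambda_0)\neq0$ and $T(\lambda_0)y(\lambda_0)=0$; its multiplicity $\nu(y)$ is the order of the zero of $Ty$ at $\lambda_0$. A right canonical matrix for $T$ at $\lambda_0$ is $Y\in\mathcal{H}^{n\times r}$ whose columns $y_1,\dots,y_r$ are root functions such that (a) $y_1(\lambda_0),\dots,y_r(\lambda_0)$ are linearly independent, (b) $\sum_{i=1}^r\nu(y_i)=\sum_{i=1}^r m_i$, (c) $\nu(y_1)\ge\cdots\ge\nu(y_r)$. A left root function is a row vector $v\in\mathcal{H}^{1\times n}$ with $v(\lambda_0)\ne0$ and $v(\lambda_0)T(\lambda_0)=0$, with multiplicity the order of the zero of $vT$ at $\lambda_0$; a left canonical matrix $V\in\mathcal{H}^{r\times n}$ is defined analogously. *)

theory Defs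
  imports "HOL-Analysis.Analysis" "Jordan_Normal_Form.Matrix_Kernel" "Jordan_Normal_Form.Determinant"
begin

text \<open>Matrix-valued functions are maps complex to complex mat (Jordan_Normal_Form matrices,
  so that the sizes n and r can vary). Column vectors are complex vec.\<close>

definition hol_mat :: "complex set \<Rightarrow> nat \<Rightarrow> nat \<Rightarrow> (complex \<Rightarrow> complex mat) \<Rightarrow> bool" where
  "hol_mat S nr nc M \<longleftrightarrow> (\<forall>z\<in>S. M z \<in> carrier_mat nr nc) \<and>
     (\<forall>i<nr. \<forall>j<nc. (\<lambda>z. M z $$ (i,j)) holomorphic_on S)"

definition hol_vec :: "complex set \<Rightarrow> nat \<Rightarrow> (complex \<Rightarrow> complex vec) \<Rightarrow> bool" where
  "hol_vec S n y \<longleftrightarrow> (\<forall>z\<in>S. y z \<in> carrier_vec n) \<and> (\<forall>i<n. (\<lambda>z. y z $ i) holomorphic_on S)"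

definition unimodular0 :: "complex \<Rightarrow> nat \<Rightarrow> (complex \<Rightarrow> complex mat) \<Rightarrow> bool" where
  "unimodular0 z0 n U \<longleftrightarrow> (\<exists>e>0. \<exists>W. hol_mat (ball z0 e) n n U \<and> hol_mat (ball z0 e) n n W \<and>
     (\<forall>z\<in>ball z0 e. U z * W z = 1\<^sub>m n \<and> W z * U z = 1\<^sub>m n))"

text \<open>ms is the list of partial multiplicities m_1 >= ... >= m_n >= 0 of T at z0
  (local Smith form: U_L T U_R = diag(chi_0^{m_1},...,chi_0^{m_n}) as germs at z0).\<close>
definition partial_mults :: "complex set \<Rightarrow> (complex \<Rightarrow> complex mat) \<Rightarrow> complex \<Rightarrow> nat \<Rightarrow> nat list \<Rightarrow> bool" where
  "partial_mults \<Omega> T z0 n ms \<longleftrightarrow> length ms = n \<and> sorted_wrt (\<ge>) ms \<and>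
     (\<exists>UL UR. unimodular0 z0 n UL \<and> unimodular0 z0 n UR \<and>
        (\<exists>e>0. ball z0 e \<subseteq> \<Omega> \<and> (\<forall>z\<in>ball z0 e.
            UL z * T z * UR z = mat_diag n (\<lambda>i. (z - z0) ^ (ms ! i)))))"

definition Delta :: "complex \<Rightarrow> nat \<Rightarrow> nat list \<Rightarrow> complex \<Rightarrow> complex mat" where
  "Delta z0 r ms z = mat_diag r (\<lambda>i. (z - z0) ^ (ms ! i))"

definition Delta_inv :: "complex \<Rightarrow> nat \<Rightarrow> nat list \<Rightarrow> complex \<Rightarrow> complex mat" where
  "Delta_inv z0 r ms z = mat_diag r (\<lambda>i. inverse ((z - z0) ^ (ms ! i)))"

definition minv :: "nat \<Rightarrow> complex mat \<Rightarrow> complex mat" where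
  "minv n A = (SOME B. B \<in> carrier_mat n n \<and> A * B = 1\<^sub>m n \<and> B * A = 1\<^sub>m n)"

text \<open>M1 doteq M2: M2 - M1 (defined on a punctured neighbourhood of z0) is holomorphic in a
  neighbourhood of z0, i.e. agrees off z0 with a holomorphic matrix function.\<close>
definition mero_eq :: "complex \<Rightarrow> nat \<Rightarrow> nat \<Rightarrow> (complex \<Rightarrow> complex mat) \<Rightarrow> (complex \<Rightarrow> complex mat) \<Rightarrow> bool" where
  "mero_eq z0 nr nc M1 M2 \<longleftrightarrow> (\<exists>e>0. \<exists>G. hol_mat (ball z0 e) nr nc G \<and>
     (\<forall>z\<in>ball z0 e - {z0}. \<forall>i<nr. \<forall>j<nc. M2 z $$ (i,j) - M1 z $$ (i,j) = G z $$ (i,j)))"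

definition vec_zero_order_is :: "complex \<Rightarrow> nat \<Rightarrow> (complex \<Rightarrow> complex vec) \<Rightarrow> nat \<Rightarrow> bool" where
  "vec_zero_order_is z0 n f k \<longleftrightarrow> (\<exists>e>0. \<exists>g. hol_vec (ball z0 e) n g \<and> g z0 \<noteq> 0\<^sub>v n \<and>
     (\<forall>z\<in>ball z0 e. f z = (z - z0) ^ k \<cdot>\<^sub>v g z))"

definition vec_zero_order :: "complex \<Rightarrow> nat \<Rightarrow> (complex \<Rightarrow> complex vec) \<Rightarrow> nat" where
  "vec_zero_order z0 n f = (THE k. vec_zero_order_is z0 n f k)"

definition root_fun :: "complex set \<Rightarrow> (complex \<Rightarrow> complex mat) \<Rightarrow> complex \<Rightarrow> nat \<Rightarrow> (complex \<Rightarrow> complex vec) \<Rightarrow> bool" where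
  "root_fun \<Omega> T z0 n y \<longleftrightarrow> hol_vec \<Omega> n y \<and> y z0 \<noteq> 0\<^sub>v n \<and> T z0 *\<^sub>v y z0 = 0\<^sub>v n"

definition root_mult :: "(complex \<Rightarrow> complex mat) \<Rightarrow> complex \<Rightarrow> nat \<Rightarrow> (complex \<Rightarrow> complex vec) \<Rightarrow> nat" where
  "root_mult T z0 n y = vec_zero_order z0 n (\<lambda>z. T z *\<^sub>v y z)"

text \<open>Left root functions: the row vector v is represented by the column vector v^T;
  vT = 0 becomes T^T v^T = 0.\<close>
definition left_root_fun :: "complex set \<Rightarrow> (complex \<Rightarrow> complex mat) \<Rightarrow> complex \<Rightarrow> nat \<Rightarrow> (complex \<Rightarrow> complex vec) \<Rightarrow> bool" where
  "left_root_fun \<Omega> T z0 n v \<longleftrightarrow> hol_vec \<Omega> n v \<and> v z0 \<noteq> 0\<^sub>v n \<and> transpose_mat (T z0) *\<^sub>v v z0 = 0\<^sub>v n"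

definition left_root_mult :: "(complex \<Rightarrow> complex mat) \<Rightarrow> complex \<Rightarrow> nat \<Rightarrow> (complex \<Rightarrow> complex vec) \<Rightarrow> nat" where
  "left_root_mult T z0 n v = vec_zero_order z0 n (\<lambda>z. transpose_mat (T z) *\<^sub>v v z)"

definition right_canonical :: "complex set \<Rightarrow> (complex \<Rightarrow> complex mat) \<Rightarrow> complex \<Rightarrow> nat \<Rightarrow> nat \<Rightarrow> nat list \<Rightarrow> (complex \<Rightarrow> complex mat) \<Rightarrow> bool" where
  "right_canonical \<Omega> T z0 n r ms Y \<longleftrightarrow> hol_mat \<Omega> n r Y \<and>
     (\<forall>i<r. root_fun \<Omega> T z0 n (\<lambda>z. col (Y z) i)) \<and>
     (\<forall>c. c \<in> carrier_vec r \<and> Y z0 *\<^sub>v c = 0\<^sub>v n \<longrightarrow> c = 0\<^sub>v r) \<and>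
     (\<Sum>i<r. root_mult T z0 n (\<lambda>z. col (Y z) i)) = (\<Sum>i<r. ms ! i) \<and>
     (\<forall>i j. i \<le> j \<and> j < r \<longrightarrow> root_mult T z0 n (\<lambda>z. col (Y z) j) \<le> root_mult T z0 n (\<lambda>z. col (Y z) i))"

definition left_canonical :: "complex set \<Rightarrow> (complex \<Rightarrow> complex mat) \<Rightarrow> complex \<Rightarrow> nat \<Rightarrow> nat \<Rightarrow> nat list \<Rightarrow> (complex \<Rightarrow> complex mat) \<Rightarrow> bool" where
  "left_canonical \<Omega> T z0 n r ms V \<longleftrightarrow> hol_mat \<Omega> r n V \<and>
     (\<forall>i<r. left_root_fun \<Omega> T z0 n (\<lambda>z. row (V z) i)) \<and>
     (\<forall>c. c \<in> carrier_vec r \<and> transpose_mat (V z0) *\<^sub>v c = 0\<^sub>v n \<longrightarrow> c = 0\<^sub>v r) \<and>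
     (\<Sum>i<r. left_root_mult T z0 n (\<lambda>z. row (V z) i)) = (\<Sum>i<r. ms ! i) \<and>
     (\<forall>i j. i \<le> j \<and> j < r \<longrightarrow> left_root_mult T z0 n (\<lambda>z. row (V z) j) \<le> left_root_mult T z0 n (\<lambda>z. row (V z) i))"

definition biorth :: "(complex \<Rightarrow> complex mat) \<Rightarrow> complex \<Rightarrow> nat \<Rightarrow> nat list \<Rightarrow> (complex \<Rightarrow> complex mat) \<Rightarrow> (complex \<Rightarrow> complex mat) \<Rightarrow> bool" where
  "biorth T z0 r ms V Y \<longleftrightarrow> mero_eq z0 r r
     (\<lambda>z. Delta_inv z0 r ms z * V z * T z * Y z * Delta_inv z0 r ms z) (Delta_inv z0 r ms)"

end

(* Let r = dim ker T(z0). Near z0 write T = L D R with L, R unimodular and D = diag((z - z0)^(m_i)).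
   A dimension count at z0 shows that canonical root functions have multiplicities exactly m_i, so
   row i of V T is (z - z0)^(m_i) times a holomorphic row. Replacing the first r rows of L^-1 by V
   therefore gives another local Smith factorization; the two new factors are invertible at z0
   because det D cancels off z0. Hence one may assume that V consists of the first r rows of L^-1.
   If Y0 denotes the first r columns of R^-1, then T^-1 = Y0 Delta^-1 V + (holomorphic), and the right
   canonical matrices biorthogonal to V are exactly the Y with Y = Y0 + H Delta near z0. Truncating
   the Taylor series of Y0 provides such a Y that is holomorphic everywhere. *)
theory Submission
  imports Defs "HOL-Complex_Analysis.Cauchy_Integral_Formula"
begin

text \<open>Two mismatches shape the argument: canonical matrices live on all of \<Omega> while the
  Smith factors exist only near \<open>z0\<close>, and the factorization supplied by
  \<open>partial_mults\<close> is unrelated to the given \<open>V\<close>. The second is why the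
  factorization is rebuilt around \<open>V\<close>. Afterwards T^-1 = Y0 Delta^-1 V + K, where K
  collects the indices of multiplicity zero and so has no pole. Canonicity of Y yields T Y = Q
  Delta, biorthogonality yields Delta^-1 V T Y = 1 - N Delta, with Q and N holomorphic near
  \<open>z0\<close>. Applying T^-1 to T Y then gives Y = Y0 + (K Q - Y0 N) Delta, which is where the
  correction H comes from. The first mismatch is resolved because Delta is invertible away from
  \<open>z0\<close>: dividing by a power of z - z0 can create a singularity at that one point only.
  Since inverse 0 = 0 in HOL, identities with Delta^-1 are proved off \<open>z0\<close>; where the
  value at \<open>z0\<close> is needed, continuity supplies it.\<close>

unbundle no vec_syntax

subsection \<open>Holomorphic functions and matrix functions near a point\<close>

lemma holomorphic_factor_linear:
  assumes "f holomorphic_on S" "open S" "f a = 0"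
  obtains h where "h holomorphic_on S" "\<And>z. z \<in> S \<Longrightarrow> f z = (z - a) * h z"
proof
  let ?h = "\<lambda>z. if z = a then deriv f a else f z / (z - a)"
  show "?h holomorphic_on S"
    by (rule pole_theorem_open_0[OF assms(1,2)]) (use assms in auto)
  show "f z = (z - a) * ?h z" for z
    using assms(3) by auto
qed

text \<open>Each induction step splits off one more Taylor coefficient, the value of the current
  remainder at \<open>a\<close>. Of the resulting polynomial only the fact that it is entire is
  recorded: this allows a germ to be replaced by a function on any domain, up to a prescribed
  order.\<close>

lemma holomorphic_taylor_remainder:
  assumes "f holomorphic_on S" "open S"
  obtains p h where "p holomorphic_on UNIV" "h holomorphic_on S"
    "\<And>z. z \<in> S \<Longrightarrow> f z = p z + (z - a) ^ N * h z"
proof -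
  have "\<exists>p h. p holomorphic_on UNIV \<and> h holomorphic_on S \<and> (\<forall>z\<in>S. f z = p z + (z - a) ^ N * h z)"
  proof (induction N)
    case 0
    show ?case
      by (rule exI[of _ "\<lambda>_. 0"], rule exI[of _ f]) (use assms in auto)
  next
    case (Suc N)
    then obtain p h where ph: "p holomorphic_on UNIV" "h holomorphic_on S"
      "\<And>z. z \<in> S \<Longrightarrow> f z = p z + (z - a) ^ N * h z"
      by blast
    have "(\<lambda>z. h z - h a) holomorphic_on S"
      using ph(2) by (intro holomorphic_intros)
    then obtain k where k: "k holomorphic_on S" "\<And>z. z \<in> S \<Longrightarrow> h z - h a = (z - a) * k z"
      using holomorphic_factor_linear[of "\<lambda>z. h z - h a" S a] assms(2) by auto
    have "f z = (p z + (z - a) ^ N * h a) + (z - a) ^ Suc N * k z" if "z \<in> S" for z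
    proof -
      have h: "h z = h a + (z - a) * k z" using k(2)[OF that] by (simp add: algebra_simps)
      show ?thesis unfolding ph(3)[OF that] h by (simp add: algebra_simps)
    qed
    moreover have "(\<lambda>z. p z + (z - a) ^ N * h a) holomorphic_on UNIV"
      using ph(1) by (intro holomorphic_intros)
    ultimately show ?case using k(1) by blast
  qed
  then show thesis using that by blast
qed

text \<open>Away from \<open>a\<close> the quotient by the power is holomorphic anyway, so a local
  factorization at \<open>a\<close> is the only missing information. The global quotient is glued
  from \<open>h\<close> on the ball and the plain quotient on the punctured set.\<close>

lemma holomorphic_factor_extend:
  assumes "f holomorphic_on S" "open S" "0 < e" "h holomorphic_on ball a e"
    and eq: "\<And>z. z \<in> ball a e \<Longrightarrow> f z = (z - a) ^ k * h z"
  obtains H where "H holomorphic_on S" "\<And>z. z \<in> S \<Longrightarrow> f z = (z - a) ^ k * H z"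
proof
  let ?H = "\<lambda>z. if z \<in> ball a e then h z else f z / (z - a) ^ k"
  have "?H holomorphic_on ball a e \<union> (S - {a})"
  proof (rule holomorphic_on_If_Un[OF assms(4)])
    show "(\<lambda>z. f z / (z - a) ^ k) holomorphic_on S - {a}"
      using assms(1) by (intro holomorphic_intros) (auto elim: holomorphic_on_subset)
  qed (use assms(2) eq in auto)
  then show "?H holomorphic_on S"
    by (rule holomorphic_on_subset) (use \<open>0 < e\<close> in auto)
  show "f z = (z - a) ^ k * ?H z" for z
    using eq[of z] \<open>0 < e\<close> by (cases "z = a") auto
qed

text \<open>Powers of z - a can be cancelled only off \<open>a\<close>; continuity then carries the
  cancelled identity to \<open>a\<close> itself.\<close>

lemma holomorphic_eq_center:
  fixes f g :: "complex \<Rightarrow> complex"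
  assumes "f holomorphic_on ball a e" "g holomorphic_on ball a e" "0 < e"
    and "\<And>z. z \<in> ball a e - {a} \<Longrightarrow> f z = g z" and "z \<in> ball a e"
  shows "f z = g z"
proof (cases "z = a")
  case True
  have "isCont f a" "isCont g a"
    using assms(1-3) by (auto intro!: continuous_on_interior[OF holomorphic_on_imp_continuous_on])
  then have "f \<midarrow>a\<rightarrow> f a" "g \<midarrow>a\<rightarrow> g a"
    by (auto simp: isCont_def)
  moreover have "\<forall>\<^sub>F z in at a. f z = g z"
    unfolding eventually_at_topological using assms(3,4)
    by (intro exI[of _ "ball a e"]) auto
  ultimately show ?thesis
    using True by (metis LIM_unique tendsto_cong)
qed (use assms in auto)

lemma nonzero_on_ball:
  fixes f :: "complex \<Rightarrow> complex"
  assumes "f holomorphic_on ball a e" "0 < e" "f a \<noteq> 0"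
  obtains d where "0 < d" "d \<le> e" "\<And>z. z \<in> ball a d \<Longrightarrow> f z \<noteq> 0"
proof -
  have "isCont f a"
    using assms(1,2) by (auto intro!: continuous_on_interior[OF holomorphic_on_imp_continuous_on])
  then obtain d where d: "0 < d" "\<And>z. dist a z < d \<Longrightarrow> f z \<noteq> 0"
    using continuous_at_avoid[of a f 0] assms(3) by (auto simp: dist_commute)
  show thesis by (rule that[of "min d e"]) (use d assms(2) in auto)
qed

section \<open>Entrywise holomorphic matrices: algebra, determinant, inverse\<close>

lemma hol_matI:
  assumes "\<And>z. z \<in> S \<Longrightarrow> M z \<in> carrier_mat nr nc"
    "\<And>i j. i < nr \<Longrightarrow> j < nc \<Longrightarrow> (\<lambda>z. M z $$ (i,j)) holomorphic_on S"
  shows "hol_mat S nr nc M"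
  using assms by (auto simp: hol_mat_def)

lemma hol_mat_carrier: "hol_mat S nr nc M \<Longrightarrow> z \<in> S \<Longrightarrow> M z \<in> carrier_mat nr nc"
  by (auto simp: hol_mat_def)

lemma hol_mat_index:
  "hol_mat S nr nc M \<Longrightarrow> i < nr \<Longrightarrow> j < nc \<Longrightarrow> (\<lambda>z. M z $$ (i,j)) holomorphic_on S"
  by (auto simp: hol_mat_def)

lemma hol_vec_carrier: "hol_vec S n y \<Longrightarrow> z \<in> S \<Longrightarrow> y z \<in> carrier_vec n"
  by (auto simp: hol_vec_def)

lemma hol_vec_index: "hol_vec S n y \<Longrightarrow> i < n \<Longrightarrow> (\<lambda>z. y z $ i) holomorphic_on S"
  by (auto simp: hol_vec_def)

lemma hol_mat_cong:
  assumes "hol_mat S nr nc M" "\<And>z. z \<in> S \<Longrightarrow> M z = M' z"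
  shows "hol_mat S nr nc M'"
proof (rule hol_matI)
  show "(\<lambda>z. M' z $$ (i, j)) holomorphic_on S" if "i < nr" "j < nc" for i j
    by (rule holomorphic_transform[OF hol_mat_index[OF assms(1) that]]) (simp add: assms(2))
qed (use assms hol_mat_carrier in fastforce)

lemma hol_mat_subset: "hol_mat S nr nc M \<Longrightarrow> S' \<subseteq> S \<Longrightarrow> hol_mat S' nr nc M"
  unfolding hol_mat_def by (meson holomorphic_on_subset subsetD)

lemma hol_vec_subset: "hol_vec S n y \<Longrightarrow> S' \<subseteq> S \<Longrightarrow> hol_vec S' n y"
  unfolding hol_vec_def by (meson holomorphic_on_subset subsetD)

lemma hol_mat_mat:
  assumes "\<And>i j. i < nr \<Longrightarrow> j < nc \<Longrightarrow> f i j holomorphic_on S"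
  shows "hol_mat S nr nc (\<lambda>z. Matrix.mat nr nc (\<lambda>(i,j). f i j z))"
  by (rule hol_matI) (auto intro!: assms)

lemma hol_mat_mult:
  assumes "hol_mat S nr n M" "hol_mat S n nc N"
  shows "hol_mat S nr nc (\<lambda>z. M z * N z)"
proof (rule hol_mat_cong)
  show "hol_mat S nr nc (\<lambda>z. Matrix.mat nr nc (\<lambda>(i,j). \<Sum>k<n. M z $$ (i,k) * N z $$ (k,j)))"
    using assms by (intro hol_mat_mat holomorphic_intros) (auto intro: hol_mat_index)
  fix z assume "z \<in> S"
  with assms have "M z \<in> carrier_mat nr n" "N z \<in> carrier_mat n nc"
    by (auto dest: hol_mat_carrier)
  then show "Matrix.mat nr nc (\<lambda>(i,j). \<Sum>k<n. M z $$ (i,k) * N z $$ (k,j)) = M z * N z"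
    by (intro eq_matI) (auto simp: scalar_prod_def atLeast0LessThan)
qed

lemma hol_mat_add:
  assumes "hol_mat S nr nc M" "hol_mat S nr nc N"
  shows "hol_mat S nr nc (\<lambda>z. M z + N z)"
proof (rule hol_mat_cong)
  show "hol_mat S nr nc (\<lambda>z. Matrix.mat nr nc (\<lambda>(i,j). M z $$ (i,j) + N z $$ (i,j)))"
    using assms by (intro hol_mat_mat holomorphic_intros) (auto intro: hol_mat_index)
  fix z assume "z \<in> S"
  with assms have "M z \<in> carrier_mat nr nc" "N z \<in> carrier_mat nr nc"
    by (auto dest: hol_mat_carrier)
  then show "Matrix.mat nr nc (\<lambda>(i,j). M z $$ (i,j) + N z $$ (i,j)) = M z + N z"
    by (intro eq_matI) auto
qed

lemma hol_mat_minus: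
  assumes "hol_mat S nr nc M" "hol_mat S nr nc N"
  shows "hol_mat S nr nc (\<lambda>z. M z - N z)"
proof (rule hol_mat_cong)
  show "hol_mat S nr nc (\<lambda>z. Matrix.mat nr nc (\<lambda>(i,j). M z $$ (i,j) - N z $$ (i,j)))"
    using assms by (intro hol_mat_mat holomorphic_intros) (auto intro: hol_mat_index)
  fix z assume "z \<in> S"
  with assms have "M z \<in> carrier_mat nr nc" "N z \<in> carrier_mat nr nc"
    by (auto dest: hol_mat_carrier)
  then show "Matrix.mat nr nc (\<lambda>(i,j). M z $$ (i,j) - N z $$ (i,j)) = M z - N z"
    by (intro eq_matI) auto
qed

lemma hol_mat_transpose:
  assumes "hol_mat S nr nc M"
  shows "hol_mat S nc nr (\<lambda>z. transpose_mat (M z))"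
proof (rule hol_mat_cong)
  show "hol_mat S nc nr (\<lambda>z. Matrix.mat nc nr (\<lambda>(i,j). M z $$ (j,i)))"
    using assms by (intro hol_mat_mat) (auto intro: hol_mat_index)
  fix z assume "z \<in> S"
  then have "M z \<in> carrier_mat nr nc"
    by (rule hol_mat_carrier[OF assms])
  then show "Matrix.mat nc nr (\<lambda>(i,j). M z $$ (j,i)) = transpose_mat (M z)"
    by (intro eq_matI) auto
qed

lemma hol_mat_diag:
  "hol_mat S n n (\<lambda>z. mat_diag n (\<lambda>i. (z - a) ^ m i))"
  unfolding mat_diag_def
proof (rule hol_mat_mat)
  show "(\<lambda>z. if i = j then (z - a) ^ m j else 0) holomorphic_on S" for i j
    by (cases "i = j") (auto intro!: holomorphic_intros)
qed

lemma hol_mat_mult_vec: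
  assumes "hol_mat S nr n M" "hol_vec S n y"
  shows "hol_vec S nr (\<lambda>z. M z *\<^sub>v y z)"
  unfolding hol_vec_def
proof (intro conjI ballI allI impI)
  fix i assume i: "i < nr"
  have "(\<lambda>z. \<Sum>k<n. M z $$ (i,k) * y z $ k) holomorphic_on S"
    using assms i by (intro holomorphic_intros) (auto intro: hol_mat_index hol_vec_index)
  then show "(\<lambda>z. (M z *\<^sub>v y z) $ i) holomorphic_on S"
  proof (rule holomorphic_transform)
    fix z assume "z \<in> S"
    then have "M z \<in> carrier_mat nr n" "y z \<in> carrier_vec n"
      using assms by (auto dest: hol_mat_carrier hol_vec_carrier)
    then show "(\<Sum>k<n. M z $$ (i,k) * y z $ k) = (M z *\<^sub>v y z) $ i"
      using i by (auto simp: scalar_prod_def atLeast0LessThan)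
  qed
qed (use assms hol_mat_carrier hol_vec_carrier in fastforce)

lemma hol_mat_col:
  assumes "hol_mat S nr nc M" "j < nc"
  shows "hol_vec S nr (\<lambda>z. col (M z) j)"
  unfolding hol_vec_def
proof (intro conjI ballI allI impI)
  fix i assume i: "i < nr"
  show "(\<lambda>z. col (M z) j $ i) holomorphic_on S"
    by (rule holomorphic_transform[OF hol_mat_index[OF assms(1) i assms(2)]])
      (use hol_mat_carrier[OF assms(1)] i assms(2) in force)
qed (use hol_mat_carrier[OF assms(1)] in fastforce)

lemma holomorphic_det:
  assumes "hol_mat S n n M"
  shows "(\<lambda>z. Determinant.det (M z)) holomorphic_on S"
proof (rule holomorphic_transform)
  show "(\<lambda>z. \<Sum>p | p permutes {0..<n}. signof p * (\<Prod>i=0..<n. M z $$ (i, p i))) holomorphic_on S"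
    using assms by (intro holomorphic_intros hol_mat_index[OF assms]) auto
qed (use assms in \<open>auto simp: det_def' dest: hol_mat_carrier\<close>)

text \<open>The inverse is the adjugate divided by the determinant. A cofactor is, up to sign, the
  determinant of a submatrix chosen independently of z, hence holomorphic.\<close>

lemma hol_mat_inverse:
  assumes M: "hol_mat S n n M" and nz: "\<And>z. z \<in> S \<Longrightarrow> Determinant.det (M z) \<noteq> 0"
  obtains M' where "hol_mat S n n M'"
    "\<And>z. z \<in> S \<Longrightarrow> M z * M' z = 1\<^sub>m n" "\<And>z. z \<in> S \<Longrightarrow> M' z * M z = 1\<^sub>m n"
proof
  let ?c = "\<lambda>z. inverse (Determinant.det (M z))"
  let ?M = "\<lambda>z. ?c z \<cdot>\<^sub>m adj_mat (M z)"
  have adj: "adj_mat (M z) \<in> carrier_mat n n"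
    "M z * adj_mat (M z) = Determinant.det (M z) \<cdot>\<^sub>m 1\<^sub>m n"
    "adj_mat (M z) * M z = Determinant.det (M z) \<cdot>\<^sub>m 1\<^sub>m n"
    if "z \<in> S" for z
    using adj_mat[OF hol_mat_carrier[OF M that]] by auto
  show "M z * ?M z = 1\<^sub>m n" "?M z * M z = 1\<^sub>m n" if "z \<in> S" for z
    using adj[OF that] hol_mat_carrier[OF M that] nz[OF that]
    by (auto simp: mult_smult_distrib mult_smult_assoc_mat intro!: eq_matI)
  have cof: "(\<lambda>z. cofactor (M z) j i) holomorphic_on S" if "i < n" "j < n" for i j
  proof -
    have "hol_mat S (n-1) (n-1) (\<lambda>z. mat_delete (M z) j i)"
    proof (rule hol_mat_cong)
      show "hol_mat S (n-1) (n-1) (\<lambda>z. Matrix.mat (n-1) (n-1) (\<lambda>(i',j').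
        M z $$ (if i' < j then i' else Suc i', if j' < i then j' else Suc j')))"
        by (intro hol_mat_mat hol_mat_index[OF M]) auto
    qed (use hol_mat_carrier[OF M] in \<open>force simp: mat_delete_def\<close>)
    then show ?thesis unfolding cofactor_def
      by (intro holomorphic_intros holomorphic_det)
  qed
  show "hol_mat S n n ?M"
  proof (rule hol_mat_cong)
    show "hol_mat S n n (\<lambda>z. Matrix.mat n n (\<lambda>(i,j). ?c z * cofactor (M z) j i))"
      using nz by (intro hol_mat_mat holomorphic_intros holomorphic_det[OF M] cof)
    fix z assume "z \<in> S"
    then have "M z \<in> carrier_mat n n"
      by (rule hol_mat_carrier[OF M])
    then show "Matrix.mat n n (\<lambda>(i,j). ?c z * cofactor (M z) j i) = ?M z"
      by (intro eq_matI) (auto simp: adj_mat_def)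
  qed
qed

lemma hol_mat_eq_center:
  assumes "hol_mat (ball a e) nr nc M" "hol_mat (ball a e) nr nc N" "0 < e"
    and "\<And>z. z \<in> ball a e - {a} \<Longrightarrow> M z = N z" and "z \<in> ball a e"
  shows "M z = N z"
proof (rule eq_matI)
  have c: "M z \<in> carrier_mat nr nc" "N z \<in> carrier_mat nr nc"
    using assms hol_mat_carrier by blast+
  show "M z $$ (i,j) = N z $$ (i,j)" if "i < dim_row (N z)" "j < dim_col (N z)" for i j
    using that c
    by (intro holomorphic_eq_center[OF hol_mat_index[OF assms(1)] hol_mat_index[OF assms(2)] assms(3) _ assms(5)])
      (auto simp: assms(4))
  show "dim_row (M z) = dim_row (N z)" "dim_col (M z) = dim_col (N z)" using c by auto
qed

section \<open>Order of vanishing of a vector function\<close>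

lemma vec_zero_order_is_unique:
  assumes "vec_zero_order_is a n f k" "vec_zero_order_is a n f l"
  shows "k = l"
proof -
  have False if lt: "k < l" and k: "vec_zero_order_is a n f k" and l: "vec_zero_order_is a n f l" for k l
  proof -
    obtain d and g :: "complex \<Rightarrow> complex Matrix.vec" where g: "0 < d" "hol_vec (ball a d) n g" "g a \<noteq> 0\<^sub>v n"
      "\<And>z. z \<in> ball a d \<Longrightarrow> f z = (z - a) ^ k \<cdot>\<^sub>v g z"
      using k by (auto simp: vec_zero_order_is_def)
    obtain e and h :: "complex \<Rightarrow> complex Matrix.vec" where h: "0 < e" "hol_vec (ball a e) n h"
      "\<And>z. z \<in> ball a e \<Longrightarrow> f z = (z - a) ^ l \<cdot>\<^sub>v h z"
      using l by (auto simp: vec_zero_order_is_def)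
    define m where "m = min d e"
    have m: "0 < m" "ball a m \<subseteq> ball a d" "ball a m \<subseteq> ball a e" using g h by (auto simp: m_def)
    \<comment> \<open>The factor (a - a) ^ (l - k) is zero because k < l. It stays unevaluated so
      that the equation is the value at \<open>a\<close> of an identity valid on the punctured
      ball.\<close>
    have "g a $ i = (a - a) ^ (l - k) * h a $ i" if i: "i < n" for i
    proof (rule holomorphic_eq_center[where f = "\<lambda>z. g z $ i" and g = "\<lambda>z. (z - a) ^ (l - k) * h z $ i", OF _ _ m(1)])
      show "(\<lambda>z. g z $ i) holomorphic_on ball a m"
        by (rule holomorphic_on_subset[OF hol_vec_index[OF g(2) i] m(2)])
      show "(\<lambda>z. (z - a) ^ (l - k) * h z $ i) holomorphic_on ball a m"
        by (intro holomorphic_intros holomorphic_on_subset[OF hol_vec_index[OF h(2) i] m(3)])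
      fix z assume z: "z \<in> ball a m - {a}"
      with m have zz: "z \<in> ball a d" "z \<in> ball a e" by auto
      have "(z - a) ^ k * g z $ i = (z - a) ^ l * h z $ i"
        using g(4)[OF zz(1)] h(3)[OF zz(2)] i hol_vec_carrier[OF g(2) zz(1)] hol_vec_carrier[OF h(2) zz(2)]
        by (metis carrier_vecD index_smult_vec(1))
      also have "\<dots> = (z - a) ^ k * ((z - a) ^ (l - k) * h z $ i)"
        using \<open>k < l\<close> by (simp flip: power_add mult.assoc)
      finally show "g z $ i = (z - a) ^ (l - k) * h z $ i" using z by auto
    qed (use m in auto)
    then have "g a = 0\<^sub>v n"
      using hol_vec_carrier[OF g(2), of a] g(1) \<open>k < l\<close> by (intro eq_vecI) auto
    then show False using g(3) by simp
  qed
  then show ?thesis using assms by (metis linorder_neqE_nat)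
qed

lemma vec_zero_order_eqI:
  "vec_zero_order_is a n f k \<Longrightarrow> vec_zero_order a n f = k"
  unfolding vec_zero_order_def using vec_zero_order_is_unique by blast

subsection \<open>Local Smith factorizations\<close>

text \<open>The matrix is a generic \<open>A\<close> because the factorization is used both for T
  and for its transpose, which exchanges left and right root functions. The inverses
  \<open>L'\<close> and \<open>R'\<close> are part of the data and share one ball with the factors,
  so no radius has to shrink inside the locale.\<close>

locale local_smith =
  fixes z0 :: complex and e :: real and n :: nat and A :: "complex \<Rightarrow> complex mat"
    and ms :: "nat list" and L L' R R' :: "complex \<Rightarrow> complex mat"
  assumes e_pos: "0 < e"
    and hol_L: "hol_mat (ball z0 e) n n L" and hol_L': "hol_mat (ball z0 e) n n L'"
    and hol_R: "hol_mat (ball z0 e) n n R" and hol_R': "hol_mat (ball z0 e) n n R'"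
    and LL': "z \<in> ball z0 e \<Longrightarrow> L z * L' z = 1\<^sub>m n"
    and L'L: "z \<in> ball z0 e \<Longrightarrow> L' z * L z = 1\<^sub>m n"
    and RR': "z \<in> ball z0 e \<Longrightarrow> R z * R' z = 1\<^sub>m n"
    and R'R: "z \<in> ball z0 e \<Longrightarrow> R' z * R z = 1\<^sub>m n"
    and factor: "z \<in> ball z0 e \<Longrightarrow> A z = L z * mat_diag n (\<lambda>i. (z - z0) ^ (ms ! i)) * R z"
begin

abbreviation D :: "complex \<Rightarrow> complex mat" where
  "D z \<equiv> mat_diag n (\<lambda>i. (z - z0) ^ (ms ! i))"

lemma center [simp]: "z0 \<in> ball z0 e"
  using e_pos by simp

lemma carrier [simp]:
  assumes "z \<in> ball z0 e"
  shows "L z \<in> carrier_mat n n" "L' z \<in> carrier_mat n n" "R z \<in> carrier_mat n n"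
    "R' z \<in> carrier_mat n n" "A z \<in> carrier_mat n n"
proof -
  show c: "L z \<in> carrier_mat n n" "L' z \<in> carrier_mat n n" "R z \<in> carrier_mat n n"
    "R' z \<in> carrier_mat n n"
    using assms hol_L hol_L' hol_R hol_R' by (auto dest: hol_mat_carrier)
  show "A z \<in> carrier_mat n n"
    unfolding factor[OF assms] using c by (intro mult_carrier_mat[of _ n n]) auto
qed

lemmas square_simps = assoc_mult_mat[of _ n n _ n _ n] mult_carrier_mat[of _ n n _ n]
  transpose_mult[of _ n n _ n] left_mult_one_mat[of _ n n] right_mult_one_mat[of _ n n]

lemma hol_A: "hol_mat (ball z0 e) n n A"
  by (rule hol_mat_cong[OF _ factor[symmetric]])
    (intro hol_mat_mult[where n=n] hol_L hol_R hol_mat_diag)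

lemma L'_mult_A:
  assumes "z \<in> ball z0 e"
  shows "L' z * A z = D z * R z"
proof -
  have "L' z * A z = (L' z * L z) * (D z * R z)"
    using carrier[OF assms] by (simp add: factor[OF assms] square_simps del: carrier)
  then show ?thesis
    using carrier[OF assms] L'L[OF assms] by (simp add: square_simps)
qed

lemma A_mult_R':
  assumes "z \<in> ball z0 e"
  shows "A z * R' z = L z * D z"
proof -
  have "A z * R' z = (L z * D z) * (R z * R' z)"
    using carrier[OF assms] by (simp add: factor[OF assms] square_simps del: carrier)
  then show ?thesis
    using carrier[OF assms] RR'[OF assms] by (simp add: square_simps)
qed

lemma transpose:
  "local_smith z0 e n (\<lambda>z. transpose_mat (A z)) ms (\<lambda>z. transpose_mat (R z))
    (\<lambda>z. transpose_mat (R' z)) (\<lambda>z. transpose_mat (L z)) (\<lambda>z. transpose_mat (L' z))"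
proof
  fix z assume z: "z \<in> ball z0 e"
  note c = carrier[OF z]
  have [simp]: "transpose_mat (D z) = D z"
    by (rule eq_matI) (auto simp: mat_diag_def)
  have "transpose_mat (A z) = transpose_mat (R z) * (D z * transpose_mat (L z))"
    using c by (simp add: factor[OF z] square_simps)
  then show "transpose_mat (A z) = transpose_mat (R z) * D z * transpose_mat (L z)"
    using c by (simp add: assoc_mult_mat[of _ n n _ n _ n])
  show "transpose_mat (R z) * transpose_mat (R' z) = 1\<^sub>m n"
    "transpose_mat (R' z) * transpose_mat (R z) = 1\<^sub>m n"
    "transpose_mat (L z) * transpose_mat (L' z) = 1\<^sub>m n"
    "transpose_mat (L' z) * transpose_mat (L z) = 1\<^sub>m n"
    using c by (simp_all flip: transpose_mult[of _ n n _ n] add: LL'[OF z] L'L[OF z] RR'[OF z] R'R[OF z])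
qed (intro e_pos hol_mat_transpose hol_L hol_L' hol_R hol_R')+

text \<open>Multiplicities are defined by a definite description, so existence of the order must be
  established before they mean anything. The order is bounded because a holomorphic multiple of
  \<open>A\<close> on the left is a power of z - z0 times the identity: too high an order of A y
  would force y to vanish at \<open>z0\<close>.\<close>

lemma vec_zero_order_exists:
  assumes "0 < d" and y: "hol_vec (ball z0 d) n y" and y0: "y z0 \<noteq> 0\<^sub>v n"
  shows "\<exists>k. vec_zero_order_is z0 n (\<lambda>z. A z *\<^sub>v y z) k"
proof -
  \<comment> \<open>Any common upper bound of the multiplicities would serve; it makes the natural
    number differences N - m_i genuine.\<close>
  define N where "N = (\<Sum>i<n. ms ! i)"
  \<comment> \<open>This is (z - z0)^N times the inverse R' D^-1 L' of A, with the poles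
    cleared.\<close>
  define C where "C z = R' z * mat_diag n (\<lambda>i. (z - z0) ^ (N - ms ! i)) * L' z" for z
  have hol_C: "hol_mat (ball z0 e) n n C"
    unfolding C_def by (intro hol_mat_mult[where n=n] hol_L' hol_R' hol_mat_diag)
  have CA: "C z * A z = (z - z0) ^ N \<cdot>\<^sub>m 1\<^sub>m n" if z: "z \<in> ball z0 e" for z
  proof -
    note c = carrier[OF z]
    let ?D = "mat_diag n (\<lambda>i. (z - z0) ^ (N - ms ! i))"
    have "C z * A z = R' z * (?D * (L' z * A z))"
      using c by (simp add: C_def assoc_mult_mat[of _ n n _ n _ n] mult_carrier_mat[of _ n n])
    also have "\<dots> = R' z * ((?D * D z) * R z)"
      using c by (simp add: L'_mult_A[OF z] assoc_mult_mat[of _ n n _ n _ n] del: mat_diag_diag)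
    also have "?D * D z = (z - z0) ^ N \<cdot>\<^sub>m 1\<^sub>m n"
      unfolding mat_diag_diag
    proof (rule eq_matI)
      fix i j assume ij: "i < dim_row ((z - z0) ^ N \<cdot>\<^sub>m 1\<^sub>m n)" "j < dim_col ((z - z0) ^ N \<cdot>\<^sub>m 1\<^sub>m n)"
      then have "ms ! j \<le> N"
        unfolding N_def by (intro member_le_sum) auto
      then show "mat_diag n (\<lambda>i. (z - z0) ^ (N - ms ! i) * (z - z0) ^ (ms ! i)) $$ (i,j)
          = ((z - z0) ^ N \<cdot>\<^sub>m 1\<^sub>m n) $$ (i,j)"
        using ij by (simp add: mat_diag_def flip: power_add)
    qed (auto simp: mat_diag_def)
    finally show ?thesis
      using c R'R[OF z] by (simp add: mult_smult_distrib[of _ n n] mult_smult_assoc_mat[of _ n n])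
  qed
  \<comment> \<open>Divisibility by the k-th power without asking that the quotient be nonzero at
    \<open>z0\<close>. This weaker property holds for k = 0 and is bounded by \<open>N\<close>, so a
    greatest k exists.\<close>
  define P where "P k \<longleftrightarrow> (\<exists>d'>0. \<exists>g. hol_vec (ball z0 d') n g \<and>
      (\<forall>z\<in>ball z0 d'. A z *\<^sub>v y z = (z - z0) ^ k \<cdot>\<^sub>v g z))" for k
  have P0: "P 0"
    unfolding P_def
  proof (intro exI[of _ "min d e"] exI[of _ "\<lambda>z. A z *\<^sub>v y z"] conjI)
    show "hol_vec (ball z0 (min d e)) n (\<lambda>z. A z *\<^sub>v y z)"
      by (intro hol_mat_mult_vec[where n=n] hol_mat_subset[OF hol_A] hol_vec_subset[OF y]) auto
  qed (use \<open>0 < d\<close> e_pos in auto)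
  have P_le: "k \<le> N" if Pk: "P k" for k
  proof (rule ccontr)
    assume k: "\<not> k \<le> N"
    obtain d' and g :: "complex \<Rightarrow> complex Matrix.vec" where g: "0 < d'" "hol_vec (ball z0 d') n g"
      "\<And>z. z \<in> ball z0 d' \<Longrightarrow> A z *\<^sub>v y z = (z - z0) ^ k \<cdot>\<^sub>v g z"
      using Pk unfolding P_def by blast
    define m where "m = Min {d, e, d'}"
    have m: "0 < m" "ball z0 m \<subseteq> ball z0 d" "ball z0 m \<subseteq> ball z0 e" "ball z0 m \<subseteq> ball z0 d'"
      using \<open>0 < d\<close> e_pos g(1) by (auto simp: m_def)
    have hol_Cg: "hol_vec (ball z0 m) n (\<lambda>z. C z *\<^sub>v g z)"
      by (intro hol_mat_mult_vec[where n=n] hol_mat_subset[OF hol_C m(3)] hol_vec_subset[OF g(2) m(4)])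
    have "y z0 $ i = (z0 - z0) ^ (k - N) * (C z0 *\<^sub>v g z0) $ i" if i: "i < n" for i
    proof (rule holomorphic_eq_center[where f = "\<lambda>z. y z $ i" and
          g = "\<lambda>z. (z - z0) ^ (k - N) * (C z *\<^sub>v g z) $ i", OF _ _ m(1)])
      show "(\<lambda>z. y z $ i) holomorphic_on ball z0 m"
        by (rule holomorphic_on_subset[OF hol_vec_index[OF y i] m(2)])
      show "(\<lambda>z. (z - z0) ^ (k - N) * (C z *\<^sub>v g z) $ i) holomorphic_on ball z0 m"
        by (intro holomorphic_intros hol_vec_index[OF hol_Cg i])
      fix z assume z: "z \<in> ball z0 m - {z0}"
      then have zz: "z \<in> ball z0 d" "z \<in> ball z0 e" "z \<in> ball z0 d'" using m by auto
      have c: "A z \<in> carrier_mat n n" "C z \<in> carrier_mat n n" "y z \<in> carrier_vec n" "g z \<in> carrier_vec n"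
        using zz carrier hol_mat_carrier[OF hol_C] hol_vec_carrier[OF y] hol_vec_carrier[OF g(2)] by auto
      have "(z - z0) ^ N \<cdot>\<^sub>v y z = (C z * A z) *\<^sub>v y z"
        unfolding CA[OF zz(2)] using c(3) by (intro eq_vecI) auto
      also have "\<dots> = C z *\<^sub>v ((z - z0) ^ k \<cdot>\<^sub>v g z)"
        using c by (simp add: assoc_mult_mat_vec[of _ n n _ n] g(3)[OF zz(3)])
      also have "\<dots> = (z - z0) ^ k \<cdot>\<^sub>v (C z *\<^sub>v g z)"
        using c by (simp add: mult_mat_vec[of _ n n])
      finally have "((z - z0) ^ N \<cdot>\<^sub>v y z) $ i = ((z - z0) ^ k \<cdot>\<^sub>v (C z *\<^sub>v g z)) $ i"
        by simp
      then have "(z - z0) ^ N * y z $ i = (z - z0) ^ N * ((z - z0) ^ (k - N) * (C z *\<^sub>v g z) $ i)"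
        using c i k by (simp flip: power_add mult.assoc)
      then show "y z $ i = (z - z0) ^ (k - N) * (C z *\<^sub>v g z) $ i"
        using z by auto
    qed (use m in auto)
    then have "y z0 = 0\<^sub>v n"
      using hol_vec_carrier[OF y, of z0] \<open>0 < d\<close> k by (intro eq_vecI) auto
    with y0 show False by simp
  qed
  obtain K where K: "P K" "\<And>k. P k \<Longrightarrow> k \<le> K"
    using Nat.ex_has_greatest_nat[of P 0 N] P0 P_le by auto
  obtain d' and g :: "complex \<Rightarrow> complex Matrix.vec" where g: "0 < d'" "hol_vec (ball z0 d') n g"
    "\<And>z. z \<in> ball z0 d' \<Longrightarrow> A z *\<^sub>v y z = (z - z0) ^ K \<cdot>\<^sub>v g z"
    using K(1) unfolding P_def by blast
  \<comment> \<open>A quotient vanishing at \<open>z0\<close> would release a further factor z - z0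
    from every component, against the maximality of \<open>K\<close>.\<close>
  have "g z0 \<noteq> 0\<^sub>v n"
  proof
    assume g0: "g z0 = 0\<^sub>v n"
    have "\<exists>h. h holomorphic_on ball z0 d' \<and> (\<forall>z\<in>ball z0 d'. g z $ i = (z - z0) * h z)" if "i < n" for i
      using holomorphic_factor_linear[OF hol_vec_index[OF g(2) that] open_ball, of z0] that g0
      by (metis index_zero_vec(1))
    then obtain h where h: "\<And>i. i < n \<Longrightarrow> h i holomorphic_on ball z0 d'"
      "\<And>i z. i < n \<Longrightarrow> z \<in> ball z0 d' \<Longrightarrow> g z $ i = (z - z0) * h i z"
      by metis
    have "P (Suc K)"
      unfolding P_def
    proof (intro exI[of _ d'] exI[of _ "\<lambda>z. Matrix.vec n (\<lambda>i. h i z)"] conjI ballI)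
      show "hol_vec (ball z0 d') n (\<lambda>z. Matrix.vec n (\<lambda>i. h i z))"
        by (auto simp: hol_vec_def h(1))
      fix z assume z: "z \<in> ball z0 d'"
      show "A z *\<^sub>v y z = (z - z0) ^ Suc K \<cdot>\<^sub>v Matrix.vec n (\<lambda>i. h i z)"
        unfolding g(3)[OF z] using hol_vec_carrier[OF g(2) z] h(2)[OF _ z]
        by (intro eq_vecI) auto
    qed (fact g(1))
    with K(2) show False by fastforce
  qed
  with g have "vec_zero_order_is z0 n (\<lambda>z. A z *\<^sub>v y z) K"
    unfolding vec_zero_order_is_def by blast
  then show ?thesis ..
qed

text \<open>Row j of D (R y) = L' (A y) equates (z - z0)^(m_j) times the j-th coordinate of R y with
  something divisible by the k-th power. If k > m_j, a positive power survives cancellation. Thus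
  high multiplicity confines R(z0) y(z0) to a coordinate subspace.\<close>

lemma vec_zero_order_gt_imp_zero:
  assumes "0 < d" and y: "hol_vec (ball z0 d) n y"
    and ord: "vec_zero_order_is z0 n (\<lambda>z. A z *\<^sub>v y z) k" and j: "j < n" "ms ! j < k"
  shows "(R z0 *\<^sub>v y z0) $ j = 0"
proof -
  obtain d' and g :: "complex \<Rightarrow> complex Matrix.vec" where g: "0 < d'" "hol_vec (ball z0 d') n g"
    "\<And>z. z \<in> ball z0 d' \<Longrightarrow> A z *\<^sub>v y z = (z - z0) ^ k \<cdot>\<^sub>v g z"
    using ord unfolding vec_zero_order_is_def by blast
  define m where "m = Min {d, e, d'}"
  have m: "0 < m" "ball z0 m \<subseteq> ball z0 d" "ball z0 m \<subseteq> ball z0 e" "ball z0 m \<subseteq> ball z0 d'"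
    using \<open>0 < d\<close> e_pos g(1) by (auto simp: m_def)
  have hol_Ry: "hol_vec (ball z0 m) n (\<lambda>z. R z *\<^sub>v y z)"
    by (intro hol_mat_mult_vec[where n=n] hol_mat_subset[OF hol_R m(3)] hol_vec_subset[OF y m(2)])
  have hol_Lg: "hol_vec (ball z0 m) n (\<lambda>z. L' z *\<^sub>v g z)"
    by (intro hol_mat_mult_vec[where n=n] hol_mat_subset[OF hol_L' m(3)] hol_vec_subset[OF g(2) m(4)])
  have "(R z0 *\<^sub>v y z0) $ j = (z0 - z0) ^ (k - ms ! j) * (L' z0 *\<^sub>v g z0) $ j"
  proof (rule holomorphic_eq_center[where f = "\<lambda>z. (R z *\<^sub>v y z) $ j" and
        g = "\<lambda>z. (z - z0) ^ (k - ms ! j) * (L' z *\<^sub>v g z) $ j", OF _ _ m(1)])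
    show "(\<lambda>z. (R z *\<^sub>v y z) $ j) holomorphic_on ball z0 m"
      by (rule hol_vec_index[OF hol_Ry j(1)])
    show "(\<lambda>z. (z - z0) ^ (k - ms ! j) * (L' z *\<^sub>v g z) $ j) holomorphic_on ball z0 m"
      by (intro holomorphic_intros hol_vec_index[OF hol_Lg j(1)])
    fix z assume z: "z \<in> ball z0 m - {z0}"
    then have zz: "z \<in> ball z0 d" "z \<in> ball z0 e" "z \<in> ball z0 d'" using m by auto
    note c = carrier[OF zz(2)] hol_vec_carrier[OF y zz(1)] hol_vec_carrier[OF g(2) zz(3)]
    have "D z *\<^sub>v (R z *\<^sub>v y z) = L' z *\<^sub>v (A z *\<^sub>v y z)"
      using c by (simp flip: assoc_mult_mat_vec[of _ n n _ n] add: L'_mult_A[OF zz(2)])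
    also have "\<dots> = (z - z0) ^ k \<cdot>\<^sub>v (L' z *\<^sub>v g z)"
      using c by (simp add: g(3)[OF zz(3)] mult_mat_vec[of _ n n])
    finally have eq: "D z *\<^sub>v (R z *\<^sub>v y z) = (z - z0) ^ k \<cdot>\<^sub>v (L' z *\<^sub>v g z)" .
    have dg: "(D z *\<^sub>v w) $ j = (z - z0) ^ (ms ! j) * w $ j" if "w \<in> carrier_vec n" for w
    proof -
      have "(D z *\<^sub>v w) $ j = (\<Sum>l<n. (if j = l then (z - z0) ^ (ms ! l) else 0) * w $ l)"
        using that j(1) by (auto simp: mat_diag_def scalar_prod_def atLeast0LessThan)
      also have "\<dots> = (\<Sum>l<n. if l = j then (z - z0) ^ (ms ! j) * w $ j else 0)"
        by (rule sum.cong) auto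
      finally show ?thesis using j(1) by simp
    qed
    have "(z - z0) ^ (ms ! j) * (R z *\<^sub>v y z) $ j = ((z - z0) ^ k \<cdot>\<^sub>v (L' z *\<^sub>v g z)) $ j"
      using c by (simp flip: dg add: eq)
    also have "\<dots> = (z - z0) ^ (ms ! j) * ((z - z0) ^ (k - ms ! j) * (L' z *\<^sub>v g z) $ j)"
      using c j by (simp flip: power_add mult.assoc)
    finally show "(R z *\<^sub>v y z) $ j = (z - z0) ^ (k - ms ! j) * (L' z *\<^sub>v g z) $ j"
      using z by auto
  qed (use m in auto)
  then show ?thesis using j by simp
qed

text \<open>If \<nu>_i > m_i, then the vectors R(z0) y_k(z0) for k \<le> i have zero coordinates
  from index i on: i + 1 independent vectors would lie in a space of dimension i. So \<nu>_i \<le>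
  m_i for all i, and equality of the sums leaves no room for a strict inequality. The constant
  matrix \<open>B\<close> stands for Y(z0) on the right and for the transpose of V(z0) on the
  left.\<close>

lemma canonical_orders:
  fixes y :: "nat \<Rightarrow> complex \<Rightarrow> complex Matrix.vec"
  defines "\<nu> \<equiv> \<lambda>i. vec_zero_order z0 n (\<lambda>z. A z *\<^sub>v y i z)"
  assumes ms: "sorted_wrt (\<ge>) ms" "length ms = n" and r: "r \<le> n" and "0 < d"
    and y: "\<And>i. i < r \<Longrightarrow> hol_vec (ball z0 d) n (y i)"
    and y0: "\<And>i. i < r \<Longrightarrow> y i z0 \<noteq> 0\<^sub>v n"
    and B: "B \<in> carrier_mat n r" "\<And>i. i < r \<Longrightarrow> col B i = y i z0"
    and indep: "\<And>c. c \<in> carrier_vec r \<Longrightarrow> B *\<^sub>v c = 0\<^sub>v n \<Longrightarrow> c = 0\<^sub>v r"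
    and sums: "(\<Sum>i<r. \<nu> i) = (\<Sum>i<r. ms ! i)"
    and desc: "\<And>i j. i \<le> j \<Longrightarrow> j < r \<Longrightarrow> \<nu> j \<le> \<nu> i"
    and i: "i < r"
  shows "vec_zero_order_is z0 n (\<lambda>z. A z *\<^sub>v y i z) (ms ! i)"
proof -
  have ord: "vec_zero_order_is z0 n (\<lambda>z. A z *\<^sub>v y i z) (\<nu> i)" if "i < r" for i
    using vec_zero_order_exists[OF \<open>0 < d\<close> y[OF that] y0[OF that]] vec_zero_order_eqI
    unfolding \<nu>_def by blast
  have le: "\<nu> i \<le> ms ! i" if i: "i < r" for i
  proof (rule ccontr)
    assume "\<not> \<nu> i \<le> ms ! i"
    then have gt: "ms ! i < \<nu> i" by simp
    define u where "u k = R z0 *\<^sub>v y k z0" for k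
    have u0: "u k $ j = 0" if "k \<le> i" "i \<le> j" "j < n" for k j
    proof -
      have "ms ! j \<le> ms ! i"
        using that ms sorted_wrt_nth_less[of "(\<ge>)" ms i j] by (cases "i = j") auto
      also note gt
      also have "\<nu> i \<le> \<nu> k" using desc that i by auto
      finally show ?thesis
        unfolding u_def using that i
        by (intro vec_zero_order_gt_imp_zero[OF \<open>0 < d\<close> y ord]) auto
    qed
    \<comment> \<open>The i + 1 vectors cut down to their first i + 1 coordinates. With indices
      starting at 0, the last row of \<open>M\<close> is zero, so its transpose kills the last unit
      vector and \<open>M\<close> is singular.\<close>
    define M where "M = Matrix.mat (Suc i) (Suc i) (\<lambda>(j,k). u k $ j)"
    have M: "M \<in> carrier_mat (Suc i) (Suc i)" by (simp add: M_def)
    have "transpose_mat M *\<^sub>v unit_vec (Suc i) i = 0\<^sub>v (Suc i)"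
      using i r by (intro eq_vecI) (auto simp: M_def u0 mult_mat_vec_def)
    moreover have "unit_vec (Suc i) i \<noteq> (0\<^sub>v (Suc i) :: complex Matrix.vec)"
      by simp
    ultimately have "Determinant.det (transpose_mat M) = 0"
      using M by (subst det_0_iff_vec_prod_zero[of _ "Suc i"]) (auto intro!: exI[of _ "unit_vec (Suc i) i"])
    then have "Determinant.det M = 0" by (simp add: det_transpose[OF M])
    then obtain c' where c': "c' \<in> carrier_vec (Suc i)" "c' \<noteq> 0\<^sub>v (Suc i)" "M *\<^sub>v c' = 0\<^sub>v (Suc i)"
      using det_0_iff_vec_prod_zero[OF M] by auto
    \<comment> \<open>The kernel vector of \<open>M\<close>, padded with zeros to a linear relation
      among all r vectors.\<close>
    define c where "c = Matrix.vec r (\<lambda>k. if k \<le> i then c' $ k else 0)"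
    have c: "c \<in> carrier_vec r" by (simp add: c_def)
    note cR = carrier[OF center]
    define W where "W = R z0 * B"
    have W: "W \<in> carrier_mat n r" using cR B(1) by (simp add: W_def)
    have Wu: "W $$ (j,k) = u k $ j" if "j < n" "k < r" for j k
      using that cR B by (auto simp: W_def u_def)
    have "W *\<^sub>v c = 0\<^sub>v n"
    proof (rule eq_vecI)
      fix j assume "j < dim_vec (0\<^sub>v n)"
      then have j: "j < n" by simp
      have "(W *\<^sub>v c) $ j = (\<Sum>k<r. u k $ j * c $ k)"
        using W c j by (auto simp: scalar_prod_def atLeast0LessThan Wu intro!: sum.cong)
      also have "\<dots> = (\<Sum>k<Suc i. u k $ j * c' $ k)"
        using i by (intro sum.mono_neutral_cong_right) (auto simp: c_def)
      \<comment> \<open>Coordinates up to i vanish by the choice of \<open>c'\<close>; all later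
        coordinates of the vectors involved are zero already.\<close>
      also have "\<dots> = 0"
      proof (cases "j \<le> i")
        case True
        then have "(M *\<^sub>v c') $ j = (\<Sum>k<Suc i. u k $ j * c' $ k)"
          using c'(1) by (simp add: M_def scalar_prod_def atLeast0LessThan)
        then show ?thesis using c'(3) True by simp
      next
        case False
        then show ?thesis using j by (intro sum.neutral) (auto simp: u0)
      qed
      finally show "(W *\<^sub>v c) $ j = 0\<^sub>v n $ j" using j by simp
    qed (use W in auto)
    then have "R' z0 *\<^sub>v (R z0 *\<^sub>v (B *\<^sub>v c)) = 0\<^sub>v n"
      using cR B(1) c by (auto simp: W_def assoc_mult_mat_vec[of _ n n _ r] intro!: eq_vecI)
    moreover have "R' z0 *\<^sub>v (R z0 *\<^sub>v (B *\<^sub>v c)) = (R' z0 * R z0) *\<^sub>v (B *\<^sub>v c)"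
      using cR B(1) c by (intro assoc_mult_mat_vec[symmetric, of _ n n _ n]) auto
    ultimately have "B *\<^sub>v c = 0\<^sub>v n"
      using B(1) c by (simp add: R'R[OF center])
    then have "c = 0\<^sub>v r" by (rule indep[OF c])
    have "c' $ k = 0" if "k < Suc i" for k
    proof -
      have "c $ k = 0" using \<open>c = 0\<^sub>v r\<close> that i by simp
      then show ?thesis using that i by (simp add: c_def)
    qed
    then have "c' = 0\<^sub>v (Suc i)" using c'(1) by (intro eq_vecI) auto
    with c'(2) show False by simp
  qed
  have "\<nu> i = ms ! i"
  proof (rule ccontr)
    assume "\<nu> i \<noteq> ms ! i"
    then have "(\<Sum>i<r. \<nu> i) < (\<Sum>i<r. ms ! i)"
      using le i by (intro sum_strict_mono_ex1) (auto intro!: bexI[of _ i] simp: le_less)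
    then show False using sums by simp
  qed
  then show ?thesis using ord[OF i] by simp
qed

text \<open>Invertible factors on either side preserve the dimension of the kernel, so it can be
  read off D(z0), whose diagonal entry is 0 for a positive multiplicity and 1 for a zero one. This
  identifies the number of positive multiplicities with the r of the theorem.\<close>

lemma positive_mults_iff:
  assumes ms: "sorted_wrt (\<ge>) ms" "length ms = n"
  shows "kernel_dim (A z0) \<le> n" "i < n \<Longrightarrow> 0 < ms ! i \<longleftrightarrow> i < kernel_dim (A z0)"
proof -
  \<comment> \<open>The alternative i = n gives the least element a meaning even when all
    multiplicities are positive.\<close>
  define s where "s = (LEAST i. i = n \<or> ms ! i = 0)"
  have s1: "s = n \<or> ms ! s = 0"
    unfolding s_def by (rule LeastI[of _ n]) simp
  have sn: "s \<le> n"
    unfolding s_def by (rule Least_le) simp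
  have s2: "0 < ms ! i" if "i < s" for i
    using not_less_Least[of i "\<lambda>i. i = n \<or> ms ! i = 0"] that unfolding s_def by auto
  have s3: "ms ! i = 0" if "s \<le> i" "i < n" for i
    using s1 that ms sorted_wrt_nth_less[of "(\<ge>)" ms s i] by (cases "s = i") auto
  note c = carrier[OF center]
  have "A z0 \<in> carrier_mat n n" using c by simp
  then have "kernel_dim (A z0) = kernel.dim n (A z0)"
    unfolding kernel_dim_def by simp
  also have "\<dots> = kernel.dim n (L z0 * D z0 * R z0)"
    by (simp only: factor[OF center])
  also have "\<dots> = kernel.dim n (L z0 * D z0)"
    using c by (intro mat_kernel_dim_mult_eq_right[OF _ _ _ RR'[OF center], where nr = n]) auto
  also have "\<dots> = kernel.dim n (D z0)"
    using c by (subst mat_kernel_mult_eq[OF _ _ _ L'L[OF center], where nc = n]) auto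
  also have "D z0 = four_block_mat (0\<^sub>m s s) (0\<^sub>m s (n - s)) (0\<^sub>m (n - s) s) (1\<^sub>m (n - s))"
    using sn s2 s3 by (intro eq_matI) (auto simp: mat_diag_def zero_power)
  also have "kernel.dim n \<dots> = kernel.dim s (0\<^sub>m s s :: complex mat) + kernel.dim (n - s) (1\<^sub>m (n - s) :: complex mat)"
    using kernel_four_block_0_mat[OF refl, of "0\<^sub>m s s" s "1\<^sub>m (n - s) :: complex mat" "n - s"] sn by simp
  also have "kernel.dim (n - s) (1\<^sub>m (n - s) :: complex mat) = 0"
    by (rule kernel_one_mat)
  also have "kernel.dim s (0\<^sub>m s s :: complex mat) = s"
  proof -
    have "mat_kernel (0\<^sub>m s s :: complex mat) = carrier_vec s"
      by (auto simp: mat_kernel_def)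
    then have "module_vec TYPE(complex) s\<lparr>carrier := mat_kernel (0\<^sub>m s s)\<rparr> = module_vec TYPE(complex) s"
      by (simp add: module_vec_def)
    then show ?thesis using vec_space.dim_is_n[where 'a = complex and n = s] by simp
  qed
  finally have "kernel_dim (A z0) = s" by simp
  then show "kernel_dim (A z0) \<le> n" "i < n \<Longrightarrow> 0 < ms ! i \<longleftrightarrow> i < kernel_dim (A z0)"
    using sn s2 s3 by (auto simp: not_less[symmetric]) (metis less_irrefl not_less)
qed

end

section \<open>Obtaining a factorization and adapting it to V\<close>

lemma partial_mults_local_smith:
  assumes pm: "partial_mults \<Omega> T z0 n ms" and T: "hol_mat \<Omega> n n T"
  obtains e L L' R R' where "local_smith z0 e n T ms L L' R R'" "ball z0 e \<subseteq> \<Omega>"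
proof -
  from pm obtain UL UR e where U: "unimodular0 z0 n UL" "unimodular0 z0 n UR"
    and e: "0 < e" "ball z0 e \<subseteq> \<Omega>" "\<And>z. z \<in> ball z0 e \<Longrightarrow>
      UL z * T z * UR z = mat_diag n (\<lambda>i. (z - z0) ^ (ms ! i))"
    unfolding partial_mults_def by blast
  from U(1) obtain a WL where a: "0 < a" "hol_mat (ball z0 a) n n UL" "hol_mat (ball z0 a) n n WL"
    "\<And>z. z \<in> ball z0 a \<Longrightarrow> UL z * WL z = 1\<^sub>m n \<and> WL z * UL z = 1\<^sub>m n"
    unfolding unimodular0_def by blast
  from U(2) obtain b WR where b: "0 < b" "hol_mat (ball z0 b) n n UR" "hol_mat (ball z0 b) n n WR"
    "\<And>z. z \<in> ball z0 b \<Longrightarrow> UR z * WR z = 1\<^sub>m n \<and> WR z * UR z = 1\<^sub>m n"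
    unfolding unimodular0_def by blast
  define m where "m = Min {e, a, b}"
  have m: "0 < m" "ball z0 m \<subseteq> ball z0 e" "ball z0 m \<subseteq> ball z0 a" "ball z0 m \<subseteq> ball z0 b"
    using e(1) a(1) b(1) by (auto simp: m_def)
  have "local_smith z0 m n T ms WL UL WR UR"
  proof
    fix z assume z: "z \<in> ball z0 m"
    then have zz: "z \<in> ball z0 e" "z \<in> ball z0 a" "z \<in> ball z0 b" using m by auto
    show "WL z * UL z = 1\<^sub>m n" "UL z * WL z = 1\<^sub>m n" "WR z * UR z = 1\<^sub>m n" "UR z * WR z = 1\<^sub>m n"
      using a(4)[OF zz(2)] b(4)[OF zz(3)] by auto
    have c: "UL z \<in> carrier_mat n n" "WL z \<in> carrier_mat n n" "UR z \<in> carrier_mat n n"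
      "WR z \<in> carrier_mat n n" "T z \<in> carrier_mat n n"
      using zz e(2) a b T by (auto dest: hol_mat_carrier)
    have "WL z * mat_diag n (\<lambda>i. (z - z0) ^ (ms ! i)) * WR z = WL z * (UL z * T z * UR z) * WR z"
      by (simp add: e(3)[OF zz(1)])
    also have "\<dots> = (WL z * UL z) * (T z * (UR z * WR z))"
      using c by (simp add: assoc_mult_mat[of _ n n _ n _ n] mult_carrier_mat[of _ n n])
    finally show "T z = WL z * mat_diag n (\<lambda>i. (z - z0) ^ (ms ! i)) * WR z"
      using a(4)[OF zz(2)] b(4)[OF zz(3)] c by simp
  qed (use m a b in \<open>auto intro: hol_mat_subset\<close>)
  then show thesis using that m(2) e(2) by blast
qed

text \<open>With \<open>V2\<close> the modified L', the vanishing orders make row i < r of V2 A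
  divisible by (z - z0)^(m_i); for i \<ge> r the row is that of L' A = D R, where m_i = 0. Hence V2
  A = D G2, and A = V2^-1 D G2 is the new factorization as soon as both matrices are invertible near
  \<open>z0\<close>. The rows of V(z0) are independent modulo the retained rows of L'(z0) because
  they have no component along them.\<close>

lemma (in local_smith) adapt_rows:
  assumes r: "r \<le> n" "\<And>i. i < n \<Longrightarrow> 0 < ms ! i \<longleftrightarrow> i < r"
    and d: "0 < d" and V: "hol_mat (ball z0 d) r n V"
    and indep: "\<And>c. c \<in> carrier_vec r \<Longrightarrow> transpose_mat (V z0) *\<^sub>v c = 0\<^sub>v n \<Longrightarrow> c = 0\<^sub>v r"
    and ord: "\<And>i. i < r \<Longrightarrow>
      vec_zero_order_is z0 n (\<lambda>z. transpose_mat (A z) *\<^sub>v Matrix.row (V z) i) (ms ! i)"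
  obtains e2 L2 L2' R2 R2' where "local_smith z0 e2 n A ms L2 L2' R2 R2'" "e2 \<le> d"
    "\<forall>z\<in>ball z0 e2. \<forall>i<r. \<forall>j<n. L2' z $$ (i,j) = V z $$ (i,j)"
proof -
  have "\<exists>d'>0. \<exists>g. hol_vec (ball z0 d') n g \<and>
      (\<forall>z\<in>ball z0 d'. transpose_mat (A z) *\<^sub>v Matrix.row (V z) i = (z - z0) ^ (ms ! i) \<cdot>\<^sub>v g z)"
    if "i < r" for i
    using ord[OF that] unfolding vec_zero_order_is_def by blast
  then obtain \<delta> and g :: "nat \<Rightarrow> complex \<Rightarrow> complex Matrix.vec" where g:
    "\<And>i. i < r \<Longrightarrow> 0 < \<delta> i" "\<And>i. i < r \<Longrightarrow> hol_vec (ball z0 (\<delta> i)) n (g i)"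
    "\<And>i z. i < r \<Longrightarrow> z \<in> ball z0 (\<delta> i) \<Longrightarrow>
      transpose_mat (A z) *\<^sub>v Matrix.row (V z) i = (z - z0) ^ (ms ! i) \<cdot>\<^sub>v g i z"
    by metis
  define m where "m = Min ({d, e} \<union> \<delta> ` {..<r})"
  have m: "0 < m" "m \<le> d" "m \<le> e" "\<And>i. i < r \<Longrightarrow> m \<le> \<delta> i"
    unfolding m_def using d e_pos g(1) by (auto intro!: Min_le simp del: Min_insert)
  have sub: "ball z0 m \<subseteq> ball z0 d" "ball z0 m \<subseteq> ball z0 e" "\<And>i. i < r \<Longrightarrow> ball z0 m \<subseteq> ball z0 (\<delta> i)"
    using m by (simp_all add: subset_ball)
  define V2 where "V2 z = Matrix.mat n n (\<lambda>(i,j). if i < r then V z $$ (i,j) else L' z $$ (i,j))" for z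
  define G2 where "G2 z = Matrix.mat n n (\<lambda>(i,j). if i < r then g i z $ j else R z $$ (i,j))" for z
  have [simp]: "V2 z \<in> carrier_mat n n" "G2 z \<in> carrier_mat n n" for z
    by (auto simp: V2_def G2_def)
  have hol_V2: "hol_mat (ball z0 m) n n V2"
    unfolding V2_def
  proof (rule hol_mat_mat)
    show "(\<lambda>z. if i < r then V z $$ (i, j) else L' z $$ (i, j)) holomorphic_on ball z0 m"
      if "i < n" "j < n" for i j
      using hol_mat_index[OF hol_mat_subset[OF V sub(1)]] hol_mat_index[OF hol_mat_subset[OF hol_L' sub(2)]] that
      by (cases "i < r") auto
  qed
  have hol_G2: "hol_mat (ball z0 m) n n G2"
    unfolding G2_def
  proof (rule hol_mat_mat)
    show "(\<lambda>z. if i < r then g i z $ j else R z $$ (i, j)) holomorphic_on ball z0 m"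
      if "i < n" "j < n" for i j
      using hol_vec_index[OF hol_vec_subset[OF g(2) sub(3)]] hol_mat_index[OF hol_mat_subset[OF hol_R sub(2)]] that
      by (cases "i < r") auto
  qed
  have V2A: "V2 z * A z = D z * G2 z" if z: "z \<in> ball z0 m" for z
  proof (rule eq_matI)
    have zz: "z \<in> ball z0 d" "z \<in> ball z0 e" using z sub by auto
    note c = carrier[OF zz(2)] hol_mat_carrier[OF V zz(1)]
    fix i j assume "i < dim_row (D z * G2 z)" "j < dim_col (D z * G2 z)"
    then have ij: "i < n" "j < n" by (auto simp: mat_diag_def G2_def)
    show "(V2 z * A z) $$ (i,j) = (D z * G2 z) $$ (i,j)"
    proof (cases "i < r")
      case True
      have "(V2 z * A z) $$ (i,j) = (\<Sum>k<n. V z $$ (i,k) * A z $$ (k,j))"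
        using c ij True by (auto simp: V2_def scalar_prod_def atLeast0LessThan)
      also have "\<dots> = (transpose_mat (A z) *\<^sub>v Matrix.row (V z) i) $ j"
        using c ij True by (auto simp: scalar_prod_def atLeast0LessThan mult.commute)
      also have "\<dots> = (z - z0) ^ (ms ! i) * g i z $ j"
        using g(3)[OF True] sub(3)[OF True] z ij hol_vec_carrier[OF g(2)[OF True], of z] by auto
      also have "\<dots> = (D z * G2 z) $$ (i,j)"
        using ij True by (subst mat_diag_mult_left[of _ n n]) (auto simp: G2_def)
      finally show ?thesis .
    next
      case False
      have "(V2 z * A z) $$ (i,j) = (L' z * A z) $$ (i,j)"
        using c ij False by (auto simp: V2_def scalar_prod_def intro!: sum.cong)
      also have "\<dots> = R z $$ (i,j)"
        unfolding L'_mult_A[OF zz(2)] using ij False r(2)[OF ij(1)] c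
        by (subst mat_diag_mult_left[of _ n n]) auto
      also have "\<dots> = (D z * G2 z) $$ (i,j)"
        using ij False r(2)[OF ij(1)] by (subst mat_diag_mult_left[of _ n n]) (auto simp: G2_def)
      finally show ?thesis .
    qed
  qed (use carrier(5)[OF subsetD[OF sub(2) z]] in \<open>auto simp: V2_def G2_def mat_diag_def\<close>)
  note c0 = carrier[OF center]
  have z0m: "z0 \<in> ball z0 m" using m(1) by simp
  have det_V2: "Determinant.det (V2 z0) \<noteq> 0"
  proof
    assume "Determinant.det (V2 z0) = 0"
    then have "Determinant.det (transpose_mat (V2 z0)) = 0"
      by (simp add: det_transpose[of _ n])
    then obtain c where c: "c \<in> carrier_vec n" "c \<noteq> 0\<^sub>v n" "transpose_mat (V2 z0) *\<^sub>v c = 0\<^sub>v n"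
      using det_0_iff_vec_prod_zero[of "transpose_mat (V2 z0)" n] by auto
    \<comment> \<open>\<open>W\<close> expresses the rows of V2(z0) in the basis formed by the rows
      of L'(z0). It turns out to be block diagonal, with an identity as lower block.\<close>
    define W where "W = V2 z0 * L z0"
    have W: "W \<in> carrier_mat n n" using c0 by (simp add: W_def mult_carrier_mat[of _ n n])
    have W1: "W $$ (i,j) = (if i = j then 1 else 0)" if "r \<le> i" "i < n" "j < n" for i j
    proof -
      have "W $$ (i,j) = (L' z0 * L z0) $$ (i,j)"
        using c0 that by (auto simp: W_def V2_def scalar_prod_def intro!: sum.cong)
      then show ?thesis using that by (simp add: L'L[OF center])
    qed
    have "W * D z0 = (V2 z0 * A z0) * R' z0"
      using c0 by (simp add: W_def A_mult_R'[OF center] square_simps)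
    also have "\<dots> = D z0 * (G2 z0 * R' z0)"
      using c0 by (simp add: V2A[OF z0m] square_simps)
    finally have WD: "W * D z0 = D z0 * (G2 z0 * R' z0)" .
    \<comment> \<open>Compare the entry on both sides of \<open>WD\<close>: column j \<ge> r of
      D(z0) is a unit vector, so the left side keeps W_ij, while row i < r of D(z0) is zero and
      kills the right side.\<close>
    have W2: "W $$ (i,j) = 0" if "i < r" "r \<le> j" "j < n" for i j
    proof -
      have "W $$ (i,j) = (W * D z0) $$ (i,j)"
        using that r(1) r(2)[of j] by (subst mat_diag_mult_right[OF W]) auto
      also have "\<dots> = 0"
        unfolding WD using that r(1) r(2)[of i] c0
        by (subst mat_diag_mult_left[of _ n n]) (auto simp: square_simps zero_power)
      finally show ?thesis .
    qed
    \<comment> \<open>Column j \<ge> r of \<open>W\<close> is the j-th unit vector, so the j-th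
      coordinate of the relation reads c_j = 0. What remains is a relation among the rows of V(z0)
      alone.\<close>
    have c2: "c $ j = 0" if j: "r \<le> j" "j < n" for j
    proof -
      have "transpose_mat W *\<^sub>v c = transpose_mat (L z0) *\<^sub>v (transpose_mat (V2 z0) *\<^sub>v c)"
        using c0 c(1) by (simp add: W_def square_simps assoc_mult_mat_vec[of _ n n _ n])
      also have "\<dots> = 0\<^sub>v n"
        unfolding c(3) using c0 by (intro eq_vecI) auto
      finally have "0 = (transpose_mat W *\<^sub>v c) $ j" using j by simp
      also have "\<dots> = (\<Sum>i<n. W $$ (i,j) * c $ i)"
        using W c(1) j by (auto simp: scalar_prod_def atLeast0LessThan)
      also have "\<dots> = (\<Sum>i<n. if i = j then c $ j else 0)"
        using W1 W2 j by (intro sum.cong) (auto simp: not_less, metis not_le)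
      finally show ?thesis using j by simp
    qed
    define c1 where "c1 = Matrix.vec r (\<lambda>i. c $ i)"
    have "transpose_mat (V z0) *\<^sub>v c1 = 0\<^sub>v n"
    proof (rule eq_vecI)
      have V0: "V z0 \<in> carrier_mat r n" using hol_mat_carrier[OF V] d by simp
      then show "dim_vec (transpose_mat (V z0) *\<^sub>v c1) = dim_vec (0\<^sub>v n)" by simp
      fix j assume "j < dim_vec (0\<^sub>v n)"
      then have j: "j < n" by simp
      have "(transpose_mat (V z0) *\<^sub>v c1) $ j = (\<Sum>i<r. V z0 $$ (i,j) * c $ i)"
        using V0 j by (auto simp: scalar_prod_def atLeast0LessThan c1_def)
      also have "\<dots> = (\<Sum>i<n. V2 z0 $$ (i,j) * c $ i)"
        using r(1) j c2 by (intro sum.mono_neutral_cong_left) (auto simp: V2_def)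
      also have "\<dots> = (transpose_mat (V2 z0) *\<^sub>v c) $ j"
        using c(1) j by (auto simp: scalar_prod_def atLeast0LessThan V2_def)
      finally show "(transpose_mat (V z0) *\<^sub>v c1) $ j = 0\<^sub>v n $ j" using c(3) by simp
    qed
    then have "c1 = 0\<^sub>v r" by (intro indep) (simp_all add: c1_def)
    then have "c $ i = 0" if "i < r" for i
      using that by (metis c1_def index_vec index_zero_vec(1))
    then have "c = 0\<^sub>v n" using c(1) c2 by (intro eq_vecI) (auto, metis not_le)
    with c(2) show False ..
  qed
  have det_unit: "Determinant.det X \<noteq> 0"
    if "X \<in> carrier_mat n n" "X' \<in> carrier_mat n n" "X * X' = 1\<^sub>m n" for X X' :: "complex mat"
    using det_mult[OF that(1,2)] that(3) by auto
  have hol_LR: "(\<lambda>z. Determinant.det (V2 z) * (Determinant.det (L z) * Determinant.det (R z)))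
      holomorphic_on ball z0 m"
    by (intro holomorphic_intros holomorphic_det[OF hol_V2] holomorphic_det[OF hol_mat_subset[OF hol_L sub(2)]]
        holomorphic_det[OF hol_mat_subset[OF hol_R sub(2)]])
  \<comment> \<open>Only V2(z0) needed a direct argument; this identity transfers its invertibility
    to G2(z0), at the very point where det D may vanish.\<close>
  have "Determinant.det (V2 z0) * (Determinant.det (L z0) * Determinant.det (R z0)) = Determinant.det (G2 z0)"
  proof (rule holomorphic_eq_center[OF hol_LR holomorphic_det[OF hol_G2] m(1) _ z0m])
    fix z assume z: "z \<in> ball z0 m - {z0}"
    then have ze: "z \<in> ball z0 e" "z \<in> ball z0 m" using sub by auto
    note c = carrier[OF ze(1)]
    have "D z * mat_diag n (\<lambda>i. inverse ((z - z0) ^ (ms ! i))) = 1\<^sub>m n"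
      using z by simp
    then have nz: "Determinant.det (D z) \<noteq> 0"
      by (rule det_unit[rotated 2]) auto
    have "Determinant.det (V2 z) * Determinant.det (A z) = Determinant.det (D z) * Determinant.det (G2 z)"
      using c by (simp flip: det_mult[of _ n] add: V2A[OF ze(2)])
    moreover have "Determinant.det (A z) = Determinant.det (L z) * Determinant.det (D z) * Determinant.det (R z)"
      using c by (simp add: factor[OF ze(1)] det_mult[of _ n] square_simps)
    ultimately have "Determinant.det (D z) * (Determinant.det (V2 z) * (Determinant.det (L z) * Determinant.det (R z)))
      = Determinant.det (D z) * Determinant.det (G2 z)"
      by (simp add: mult_ac)
    with nz show "Determinant.det (V2 z) * (Determinant.det (L z) * Determinant.det (R z)) = Determinant.det (G2 z)"
      by simp
  qed
  moreover have "Determinant.det (L z0) \<noteq> 0" "Determinant.det (R z0) \<noteq> 0"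
    using det_unit[OF _ _ LL'[OF center]] det_unit[OF _ _ RR'[OF center]] c0 by auto
  ultimately have "Determinant.det (V2 z0) * Determinant.det (G2 z0) \<noteq> 0"
    using det_V2 by auto
  then obtain e2 where e2: "0 < e2" "e2 \<le> m"
    "\<And>z. z \<in> ball z0 e2 \<Longrightarrow> Determinant.det (V2 z) * Determinant.det (G2 z) \<noteq> 0"
    using nonzero_on_ball[of "\<lambda>z. Determinant.det (V2 z) * Determinant.det (G2 z)" z0 m]
      holomorphic_on_mult[OF holomorphic_det[OF hol_V2] holomorphic_det[OF hol_G2]] m(1) by blast
  have sub2: "ball z0 e2 \<subseteq> ball z0 m" using e2(2) by auto
  note hol2 = hol_mat_subset[OF hol_V2 sub2] hol_mat_subset[OF hol_G2 sub2]
  obtain Vi where Vi: "hol_mat (ball z0 e2) n n Vi"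
    "\<And>z. z \<in> ball z0 e2 \<Longrightarrow> V2 z * Vi z = 1\<^sub>m n" "\<And>z. z \<in> ball z0 e2 \<Longrightarrow> Vi z * V2 z = 1\<^sub>m n"
    using hol_mat_inverse[OF hol2(1)] e2(3) by (metis mult_eq_0_iff)
  obtain Gi where Gi: "hol_mat (ball z0 e2) n n Gi"
    "\<And>z. z \<in> ball z0 e2 \<Longrightarrow> G2 z * Gi z = 1\<^sub>m n" "\<And>z. z \<in> ball z0 e2 \<Longrightarrow> Gi z * G2 z = 1\<^sub>m n"
    using hol_mat_inverse[OF hol2(2)] e2(3) by (metis mult_eq_0_iff)
  show thesis
  proof (rule that)
    show "local_smith z0 e2 n A ms Vi V2 G2 Gi"
    proof
      fix z assume z: "z \<in> ball z0 e2"
      then have zm: "z \<in> ball z0 m" "z \<in> ball z0 e" using sub2 sub(2) by blast+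
      note c = carrier[OF zm(2)] hol_mat_carrier[OF Vi(1) z]
      have "A z = (Vi z * V2 z) * A z" using c by (simp add: Vi(3)[OF z] square_simps)
      also have "\<dots> = Vi z * (V2 z * A z)" using c by (simp add: square_simps)
      also have "\<dots> = Vi z * D z * G2 z" using c by (simp add: V2A[OF zm(1)] square_simps)
      finally show "A z = Vi z * D z * G2 z" .
    qed (use e2(1) hol2 Vi Gi in auto)
    show "e2 \<le> d" using e2(2) m by simp
    show "\<forall>z\<in>ball z0 e2. \<forall>i<r. \<forall>j<n. V2 z $$ (i,j) = V z $$ (i,j)"
      using r(1) by (simp add: V2_def)
  qed
qed

subsection \<open>Biorthogonal canonical matrices\<close>

text \<open>The side conditions are equations between dimensions, so that in products of rectangular
  matrices no intermediate size has to be named.\<close>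

lemma mat_assoc:
  fixes A B C :: "complex mat"
  assumes "dim_col A = dim_row B" "dim_col B = dim_row C"
  shows "A * B * C = A * (B * C)"
  using assms by (intro assoc_mult_mat[of _ "dim_row A" "dim_col A" _ "dim_col B" _ "dim_col C"]) auto

lemma mat_distrib:
  fixes A B C :: "complex mat"
  assumes "dim_row A = dim_row B" "dim_col A = dim_col B"
  shows "dim_col B = dim_row C \<Longrightarrow> (A + B) * C = A * C + B * C"
    and "dim_col B = dim_row C \<Longrightarrow> (A - B) * C = A * C - B * C"
    and "dim_row B = dim_col C \<Longrightarrow> C * (A + B) = C * A + C * B"
    and "dim_row B = dim_col C \<Longrightarrow> C * (A - B) = C * A - C * B"
  using assms
  by (auto intro!: add_mult_distrib_mat[of _ "dim_row A" "dim_col A" _ _ "dim_col C"]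
      minus_mult_distrib_mat[of _ "dim_row A" "dim_col A" _ _ "dim_col C"]
      mult_add_distrib_mat[of _ "dim_row C" "dim_col C" _ "dim_col B"]
      mult_minus_distrib_mat[of _ "dim_row C" "dim_col C" _ "dim_col B"])

text \<open>The assumption \<open>rows\<close> is what \<open>adapt_rows\<close> delivers.
  \<open>V\<close> is needed only on the ball, whereas \<Omega> is the domain of the right canonical
  matrices to be compared.\<close>

locale adapted_smith = local_smith z0 e n T ms L L' R R'
  for z0 e n T ms L L' R R' +
  fixes \<Omega> :: "complex set" and V :: "complex \<Rightarrow> complex mat" and r :: nat
  assumes open_\<Omega>: "open \<Omega>" and ball_subset: "ball z0 e \<subseteq> \<Omega>"
    and hol_V: "hol_mat (ball z0 e) r n V"
    and r_le: "r \<le> n" and pos_iff: "i < n \<Longrightarrow> 0 < ms ! i \<longleftrightarrow> i < r"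
    and desc: "sorted_wrt (\<ge>) ms" and len: "length ms = n"
    and rows: "z \<in> ball z0 e \<Longrightarrow> i < r \<Longrightarrow> j < n \<Longrightarrow> L' z $$ (i,j) = V z $$ (i,j)"
begin

section \<open>Blocks of an adapted factorization and the inverse of T\<close>

definition Y\<^sub>0 :: "complex \<Rightarrow> complex mat" where
  "Y\<^sub>0 z = Matrix.mat n r (\<lambda>ij. R' z $$ ij)"

text \<open>\<open>F\<close> and \<open>G\<close> below are the quotients in T Y0 = F Delta and V T
  = Delta G; they also satisfy V F = 1 and G Y0 = 1.\<close>

definition F :: "complex \<Rightarrow> complex mat" where
  "F z = Matrix.mat n r (\<lambda>ij. L z $$ ij)"

definition G :: "complex \<Rightarrow> complex mat" where
  "G z = Matrix.mat r n (\<lambda>ij. R z $$ ij)"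

text \<open>The share of the indices k \<ge> r in R' D^-1 L'. Their multiplicities are zero, so no
  inverse power appears and \<open>K\<close> is holomorphic also at \<open>z0\<close>.\<close>

definition K :: "complex \<Rightarrow> complex mat" where
  "K z = Matrix.mat n n (\<lambda>(i,j). \<Sum>k\<in>{r..<n}. R' z $$ (i,k) * L' z $$ (k,j))"

abbreviation \<Delta> :: "complex \<Rightarrow> complex mat" where
  "\<Delta> \<equiv> Delta z0 r ms"

abbreviation \<Delta>i :: "complex \<Rightarrow> complex mat" where
  "\<Delta>i \<equiv> Delta_inv z0 r ms"

lemma truncated_carrier [simp]:
  "Y\<^sub>0 z \<in> carrier_mat n r" "F z \<in> carrier_mat n r" "G z \<in> carrier_mat r n" "K z \<in> carrier_mat n n"
  "\<Delta> z \<in> carrier_mat r r" "\<Delta>i z \<in> carrier_mat r r"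
  by (auto simp: Y\<^sub>0_def F_def G_def K_def Delta_def Delta_inv_def)

lemmas truncated_dim [simp] = truncated_carrier[THEN carrier_matD(1)] truncated_carrier[THEN carrier_matD(2)]

lemma V_carrier [simp]: "z \<in> ball z0 e \<Longrightarrow> V z \<in> carrier_mat r n"
  using hol_V by (rule hol_mat_carrier)

lemma hol_Y\<^sub>0: "hol_mat (ball z0 e) n r Y\<^sub>0"
  using hol_R' r_le by (intro hol_matI) (auto simp: Y\<^sub>0_def intro!: hol_mat_index)

lemma hol_F: "hol_mat (ball z0 e) n r F"
  using hol_L r_le by (intro hol_matI) (auto simp: F_def intro!: hol_mat_index)

lemma hol_G: "hol_mat (ball z0 e) r n G"
  using hol_R r_le by (intro hol_matI) (auto simp: G_def intro!: hol_mat_index)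

lemma hol_K: "hol_mat (ball z0 e) n n K"
  unfolding K_def
  by (intro hol_mat_mat holomorphic_intros) (auto intro!: hol_mat_index[OF hol_R'] hol_mat_index[OF hol_L'])

lemma hol_\<Delta>: "hol_mat S r r \<Delta>"
  unfolding Delta_def by (rule hol_mat_diag)

lemma \<Delta>_inverse: "z \<noteq> z0 \<Longrightarrow> \<Delta> z * \<Delta>i z = 1\<^sub>m r" "z \<noteq> z0 \<Longrightarrow> \<Delta>i z * \<Delta> z = 1\<^sub>m r"
  by (simp_all add: Delta_def Delta_inv_def)

text \<open>All r multiplicities in Delta are positive. Consequently a correction H Delta never
  changes the value of Y at \<open>z0\<close>.\<close>

lemma \<Delta>_center: "\<Delta> z0 = 0\<^sub>m r r"
  using pos_iff r_le by (intro eq_matI) (auto simp: Delta_def mat_diag_def zero_power)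

lemma mult_\<Delta>: "M \<in> carrier_mat k r \<Longrightarrow>
    M * \<Delta> z = Matrix.mat k r (\<lambda>(i,j). M $$ (i,j) * (z - z0) ^ (ms ! j))"
  unfolding Delta_def by (rule mat_diag_mult_right)

lemma V_mult_F:
  assumes z: "z \<in> ball z0 e"
  shows "V z * F z = 1\<^sub>m r"
proof (rule eq_matI)
  fix i j assume ij: "i < dim_row (1\<^sub>m r)" "j < dim_col (1\<^sub>m r)"
  have "(V z * F z) $$ (i,j) = (L' z * L z) $$ (i,j)"
    using ij r_le carrier[OF z] V_carrier[OF z] rows[OF z]
    by (auto simp: F_def scalar_prod_def intro!: sum.cong)
  then show "(V z * F z) $$ (i,j) = 1\<^sub>m r $$ (i,j)"
    using ij r_le by (simp add: L'L[OF z])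
qed (use V_carrier[OF z] in \<open>auto simp: F_def\<close>)

lemma G_mult_Y\<^sub>0:
  assumes z: "z \<in> ball z0 e"
  shows "G z * Y\<^sub>0 z = 1\<^sub>m r"
proof (rule eq_matI)
  fix i j assume ij: "i < dim_row (1\<^sub>m r)" "j < dim_col (1\<^sub>m r)"
  have "(G z * Y\<^sub>0 z) $$ (i,j) = (R z * R' z) $$ (i,j)"
    using ij r_le carrier[OF z] by (auto simp: G_def Y\<^sub>0_def scalar_prod_def intro!: sum.cong)
  then show "(G z * Y\<^sub>0 z) $$ (i,j) = 1\<^sub>m r $$ (i,j)"
    using ij r_le by (simp add: RR'[OF z])
qed (auto simp: G_def Y\<^sub>0_def)

lemma T_mult_Y\<^sub>0:
  assumes z: "z \<in> ball z0 e"
  shows "T z * Y\<^sub>0 z = F z * \<Delta> z"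
proof (rule eq_matI)
  fix i j assume "i < dim_row (F z * \<Delta> z)" "j < dim_col (F z * \<Delta> z)"
  then have ij: "i < n" "j < r" by (auto simp: F_def Delta_def mat_diag_def)
  have "(T z * Y\<^sub>0 z) $$ (i,j) = (T z * R' z) $$ (i,j)"
    using ij r_le carrier[OF z] by (auto simp: Y\<^sub>0_def scalar_prod_def intro!: sum.cong)
  also have "\<dots> = (F z * \<Delta> z) $$ (i,j)"
    unfolding A_mult_R'[OF z] using ij r_le carrier[OF z]
    by (simp add: mult_\<Delta>[OF truncated_carrier(2)] mat_diag_mult_right[of _ n n], simp add: F_def)
  finally show "(T z * Y\<^sub>0 z) $$ (i,j) = (F z * \<Delta> z) $$ (i,j)" .
qed (use carrier[OF z] in \<open>auto simp: F_def Y\<^sub>0_def Delta_def mat_diag_def\<close>)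

lemma V_mult_T:
  assumes z: "z \<in> ball z0 e"
  shows "V z * T z = \<Delta> z * G z"
proof (rule eq_matI)
  fix i j assume "i < dim_row (\<Delta> z * G z)" "j < dim_col (\<Delta> z * G z)"
  then have ij: "i < r" "j < n" by (auto simp: G_def Delta_def mat_diag_def)
  have "(V z * T z) $$ (i,j) = (L' z * T z) $$ (i,j)"
    using ij r_le carrier[OF z] V_carrier[OF z] rows[OF z]
    by (auto simp: scalar_prod_def intro!: sum.cong)
  also have "\<dots> = (\<Delta> z * G z) $$ (i,j)"
    unfolding L'_mult_A[OF z] Delta_def using ij r_le carrier[OF z]
    by (simp add: mat_diag_mult_left[of _ n n] mat_diag_mult_left[of _ r n], simp add: G_def)
  finally show "(V z * T z) $$ (i,j) = (\<Delta> z * G z) $$ (i,j)" .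
qed (use carrier[OF z] V_carrier[OF z] in \<open>auto simp: G_def Delta_def mat_diag_def\<close>)

text \<open>Off \<open>z0\<close> the inverse is R' D^-1 L'. Split the inner summation at r: below r
  the rows of L' are those of \<open>V\<close>, which gives Y0 Delta^-1 V, and the rest is
  \<open>K\<close>.\<close>

lemma inverse_T:
  assumes z: "z \<in> ball z0 e" "z \<noteq> z0"
  shows "T z * (Y\<^sub>0 z * \<Delta>i z * V z + K z) = 1\<^sub>m n" "(Y\<^sub>0 z * \<Delta>i z * V z + K z) * T z = 1\<^sub>m n"
proof -
  note c = carrier[OF z(1)] V_carrier[OF z(1)]
  let ?Di = "mat_diag n (\<lambda>i. inverse ((z - z0) ^ (ms ! i)))"
  have ms0: "ms ! k = 0" if "r \<le> k" "k < n" for k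
    using that pos_iff by fastforce
  have D1: "D z * ?Di = 1\<^sub>m n" "?Di * D z = 1\<^sub>m n" using z by simp_all
  have eq: "Y\<^sub>0 z * \<Delta>i z * V z + K z = R' z * ?Di * L' z"
  proof (rule eq_matI)
    fix i j assume "i < dim_row (R' z * ?Di * L' z)" "j < dim_col (R' z * ?Di * L' z)"
    then have ij: "i < n" "j < n" using c by auto
    have "(R' z * ?Di * L' z) $$ (i,j)
        = (\<Sum>k<n. R' z $$ (i,k) * inverse ((z - z0) ^ (ms ! k)) * L' z $$ (k,j))"
      using c ij by (simp add: mat_diag_mult_right[of _ n n] scalar_prod_def atLeast0LessThan)
    also have "{..<n} = {..<r} \<union> {r..<n}" using r_le by auto
    also have "(\<Sum>k\<in>{..<r} \<union> {r..<n}. R' z $$ (i,k) * inverse ((z - z0) ^ (ms ! k)) * L' z $$ (k,j))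
      = (\<Sum>k<r. R' z $$ (i,k) * inverse ((z - z0) ^ (ms ! k)) * L' z $$ (k,j))
        + (\<Sum>k\<in>{r..<n}. R' z $$ (i,k) * inverse ((z - z0) ^ (ms ! k)) * L' z $$ (k,j))"
      by (intro sum.union_disjoint) auto
    also have "(\<Sum>k\<in>{r..<n}. R' z $$ (i,k) * inverse ((z - z0) ^ (ms ! k)) * L' z $$ (k,j)) = K z $$ (i,j)"
      using ij ms0 by (auto simp: K_def intro!: sum.cong)
    also have "(\<Sum>k<r. R' z $$ (i,k) * inverse ((z - z0) ^ (ms ! k)) * L' z $$ (k,j))
      = (Y\<^sub>0 z * \<Delta>i z * V z) $$ (i,j)"
      using ij c r_le unfolding Delta_inv_def
      by (simp add: mat_diag_mult_right[of _ n r] scalar_prod_def atLeast0LessThan)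
        (auto simp: Y\<^sub>0_def rows[OF z(1)] intro!: sum.cong)
    finally show "(Y\<^sub>0 z * \<Delta>i z * V z + K z) $$ (i,j) = (R' z * ?Di * L' z) $$ (i,j)"
      using ij by (simp add: K_def)
  qed (use c in \<open>auto simp: K_def\<close>)
  have "T z * (R' z * ?Di * L' z) = (T z * R' z) * (?Di * L' z)"
    using c by (simp add: square_simps)
  also have "\<dots> = L z * ((D z * ?Di) * L' z)"
    using c by (simp add: A_mult_R'[OF z(1)] square_simps del: mat_diag_diag)
  finally show "T z * (Y\<^sub>0 z * \<Delta>i z * V z + K z) = 1\<^sub>m n"
    using c by (simp add: eq D1 LL'[OF z(1)] square_simps del: mat_diag_diag)
  have "(R' z * ?Di * L' z) * T z = R' z * (?Di * (L' z * T z))"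
    using c by (simp add: square_simps)
  also have "\<dots> = R' z * ((?Di * D z) * R z)"
    using c by (simp add: L'_mult_A[OF z(1)] square_simps del: mat_diag_diag)
  finally show "(Y\<^sub>0 z * \<Delta>i z * V z + K z) * T z = 1\<^sub>m n"
    using c by (simp add: eq D1 R'R[OF z(1)] square_simps del: mat_diag_diag)
qed

lemma minv_T:
  assumes z: "z \<in> ball z0 e" "z \<noteq> z0"
  shows "minv n (T z) = Y\<^sub>0 z * \<Delta>i z * V z + K z"
  unfolding minv_def
proof (rule some_equality)
  let ?P = "Y\<^sub>0 z * \<Delta>i z * V z + K z"
  have P: "?P \<in> carrier_mat n n" by simp
  show "?P \<in> carrier_mat n n \<and> T z * ?P = 1\<^sub>m n \<and> ?P * T z = 1\<^sub>m n"
    using inverse_T[OF z] P by blast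
  fix B assume B: "B \<in> carrier_mat n n \<and> T z * B = 1\<^sub>m n \<and> B * T z = 1\<^sub>m n"
  have "B = B * (T z * ?P)" using B P by (simp add: inverse_T(1)[OF z] right_mult_one_mat[of _ n n])
  also have "\<dots> = (B * T z) * ?P"
    using B P carrier[OF z(1)] by (intro assoc_mult_mat[symmetric, of _ n n _ n _ n]) auto
  also have "\<dots> = ?P" using B P by simp
  finally show "B = ?P" .
qed

text \<open>The local form to which canonicity and biorthogonality together are reduced. The bound d
  \<le> e keeps the ball where \<open>Y\<^sub>0\<close> is known to be holomorphic.\<close>

definition represents :: "(complex \<Rightarrow> complex mat) \<Rightarrow> (complex \<Rightarrow> complex mat) \<Rightarrow> real \<Rightarrow> bool" where
  "represents Y H d \<longleftrightarrow> 0 < d \<and> d \<le> e \<and> hol_mat (ball z0 d) n r H \<and>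
     (\<forall>z\<in>ball z0 d. Y z = Y\<^sub>0 z + H z * \<Delta> z)"

text \<open>From T Y0 = F Delta one gets T Y = (F + T H) Delta, so column j vanishes to order at
  least m_j; the order is exact since V(z0) is a left inverse of the quotient at \<open>z0\<close>.
  Independence at \<open>z0\<close> follows from G Y0 = 1, and V T = Delta G turns the
  biorthogonality expression into Delta^-1 + G H.\<close>

lemma represents_canonical_biorth:
  assumes Y: "hol_mat \<Omega> n r Y" and rep: "represents Y H d"
  shows "right_canonical \<Omega> T z0 n r ms Y" "biorth T z0 r ms V Y"
proof -
  have d: "0 < d" "ball z0 d \<subseteq> ball z0 e" and H: "hol_mat (ball z0 d) n r H"
    and Y_eq: "\<And>z. z \<in> ball z0 d \<Longrightarrow> Y z = Y\<^sub>0 z + H z * \<Delta> z"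
    using rep by (auto simp: represents_def)
  have zd: "z0 \<in> ball z0 d" using d by simp
  note c0 = carrier[OF center] V_carrier[OF center] hol_mat_carrier[OF H zd]
  note dims0 = c0[THEN carrier_matD(1)] c0[THEN carrier_matD(2)]
  define Q where "Q z = F z + T z * H z" for z
  have hol_Q: "hol_mat (ball z0 d) n r Q"
    unfolding Q_def by (intro hol_mat_add hol_mat_mult[where n = n] hol_mat_subset[OF hol_F d(2)] H hol_mat_subset[OF hol_A d(2)])
  have TY: "T z * Y z = Q z * \<Delta> z" if z: "z \<in> ball z0 d" for z
  proof -
    have ze: "z \<in> ball z0 e" using z d by auto
    note c = carrier[OF ze] hol_mat_carrier[OF H z]
    note dims = c[THEN carrier_matD(1)] c[THEN carrier_matD(2)]
    show ?thesis
      by (simp add: Y_eq[OF z] Q_def mat_distrib mat_assoc dims T_mult_Y\<^sub>0[OF ze])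
  qed
  \<comment> \<open>The perturbation contributes V T H = Delta G H, which is zero at
    \<open>z0\<close>; what is left is V F = 1.\<close>
  have VQ: "V z0 * Q z0 = 1\<^sub>m r"
  proof -
    have "V z0 * Q z0 = V z0 * F z0 + V z0 * (T z0 * H z0)"
      unfolding Q_def by (simp add: mat_distrib dims0)
    also have "V z0 * (T z0 * H z0) = (\<Delta> z0 * G z0) * H z0"
      by (simp add: mat_assoc[symmetric] V_mult_T[OF center] dims0)
    also have "\<dots> = 0\<^sub>m r r"
      by (simp add: \<Delta>_center dims0)
    finally show ?thesis by (simp add: V_mult_F[OF center])
  qed
  have Y0: "Y z0 = Y\<^sub>0 z0"
    by (simp add: Y_eq[OF zd] \<Delta>_center dims0)
  have col_TY: "T z *\<^sub>v col (Y z) j = (z - z0) ^ (ms ! j) \<cdot>\<^sub>v col (Q z) j" if "z \<in> ball z0 d" "j < r" for z j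
  proof -
    have ze: "z \<in> ball z0 e" using that d by auto
    have c: "Y z \<in> carrier_mat n r" "Q z \<in> carrier_mat n r"
      using hol_mat_carrier[OF Y] hol_mat_carrier[OF hol_Q that(1)] ze ball_subset by auto
    have "T z *\<^sub>v col (Y z) j = col (T z * Y z) j"
      using c that carrier[OF ze] by (intro col_mult2[symmetric, of _ n n _ r]) auto
    also have "\<dots> = (z - z0) ^ (ms ! j) \<cdot>\<^sub>v col (Q z) j"
      unfolding TY[OF that(1)] mult_\<Delta>[OF c(2)] using c that by (intro eq_vecI) auto
    finally show ?thesis .
  qed
  have ord: "vec_zero_order_is z0 n (\<lambda>z. T z *\<^sub>v col (Y z) j) (ms ! j)" if j: "j < r" for j
    unfolding vec_zero_order_is_def
  proof (intro exI conjI ballI)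
    show "hol_vec (ball z0 d) n (\<lambda>z. col (Q z) j)" by (rule hol_mat_col[OF hol_Q j])
    show "col (Q z0) j \<noteq> 0\<^sub>v n"
    proof
      assume 0: "col (Q z0) j = 0\<^sub>v n"
      have "col (V z0 * Q z0) j = V z0 *\<^sub>v col (Q z0) j"
        using c0 j hol_mat_carrier[OF hol_Q zd] by (intro col_mult2[of _ r n _ r]) auto
      also have "\<dots> = 0\<^sub>v r" unfolding 0 using c0 by (intro eq_vecI) auto
      finally show False using j by (simp add: VQ)
    qed
    show "T z *\<^sub>v col (Y z) j = (z - z0) ^ (ms ! j) \<cdot>\<^sub>v col (Q z) j" if "z \<in> ball z0 d" for z
      by (rule col_TY[OF that j])
  qed (fact d(1))
  have mult: "root_mult T z0 n (\<lambda>z. col (Y z) j) = ms ! j" if "j < r" for j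
    unfolding root_mult_def by (intro vec_zero_order_eqI ord that)
  have inj: "c = 0\<^sub>v r" if c: "c \<in> carrier_vec r" "Y z0 *\<^sub>v c = 0\<^sub>v n" for c
  proof -
    have "c = (G z0 * Y\<^sub>0 z0) *\<^sub>v c" using c by (simp add: G_mult_Y\<^sub>0[OF center])
    also have "\<dots> = G z0 *\<^sub>v 0\<^sub>v n"
      using c Y0 by (simp add: assoc_mult_mat_vec[of _ r n _ r])
    also have "\<dots> = 0\<^sub>v r" by (intro eq_vecI) (auto simp: G_def)
    finally show ?thesis .
  qed
  show "right_canonical \<Omega> T z0 n r ms Y"
    unfolding right_canonical_def
  proof (intro conjI allI impI)
    fix j assume j: "j < r"
    show "root_fun \<Omega> T z0 n (\<lambda>z. col (Y z) j)"
      unfolding root_fun_def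
    proof (intro conjI)
      show "hol_vec \<Omega> n (\<lambda>z. col (Y z) j)" by (rule hol_mat_col[OF Y j])
      have "Y z0 *\<^sub>v unit_vec r j = col (Y z0) j"
        using j by (intro eq_vecI) (auto simp: Y0 Y\<^sub>0_def)
      moreover have "unit_vec r j \<noteq> (0\<^sub>v r :: complex Matrix.vec)" using j by simp
      ultimately show "col (Y z0) j \<noteq> 0\<^sub>v n" using inj[of "unit_vec r j"] by auto
      show "T z0 *\<^sub>v col (Y z0) j = 0\<^sub>v n"
        unfolding col_TY[OF zd j] using j r_le pos_iff[of j] hol_mat_carrier[OF hol_Q zd]
        by (intro eq_vecI) (auto simp: zero_power)
    qed
  next
    show "c = 0\<^sub>v r" if "c \<in> carrier_vec r \<and> Y z0 *\<^sub>v c = 0\<^sub>v n" for c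
      using inj that by blast
    show "root_mult T z0 n (\<lambda>z. col (Y z) j) \<le> root_mult T z0 n (\<lambda>z. col (Y z) i)"
      if "i \<le> j \<and> j < r" for i j
      using that desc len r_le sorted_wrt_nth_less[of "(\<ge>)" ms i j] by (cases "i = j") (auto simp: mult)
  qed (use Y mult in auto)
  show "biorth T z0 r ms V Y"
    unfolding biorth_def mero_eq_def
  proof (intro exI conjI ballI allI impI)
    let ?N = "\<lambda>z. 0\<^sub>m r r - G z * H z"
    show "hol_mat (ball z0 d) r r ?N"
    proof (intro hol_mat_minus hol_mat_mult[where n = n] hol_mat_subset[OF hol_G d(2)] H)
      show "hol_mat (ball z0 d) r r (\<lambda>z. 0\<^sub>m r r)" by (rule hol_matI) auto
    qed
    fix z i j assume z: "z \<in> ball z0 d - {z0}" and ij: "i < r" "j < r"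
    then have zd: "z \<in> ball z0 d" "z \<noteq> z0" and ze: "z \<in> ball z0 e" using d by auto
    note c = carrier[OF ze] V_carrier[OF ze] hol_mat_carrier[OF H zd(1)]
    have GH: "G z * H z \<in> carrier_mat r r" using c by (intro mult_carrier_mat[of _ r n]) auto
    have Yc: "Y z \<in> carrier_mat n r" using hol_mat_carrier[OF Y] ze ball_subset by auto
    note dims = c[THEN carrier_matD(1)] c[THEN carrier_matD(2)] Yc[THEN carrier_matD(1)] Yc[THEN carrier_matD(2)]
    have GY: "G z * Y z = 1\<^sub>m r + G z * (H z * \<Delta> z)"
      by (simp add: Y_eq[OF zd(1)] mat_distrib dims G_mult_Y\<^sub>0[OF ze])
    have "\<Delta>i z * V z * T z * Y z = \<Delta>i z * ((V z * T z) * Y z)"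
      by (simp add: mat_assoc dims)
    also have "\<dots> = (\<Delta>i z * \<Delta> z) * (G z * Y z)"
      unfolding V_mult_T[OF ze] by (simp add: mat_assoc dims)
    also have "\<dots> = 1\<^sub>m r + G z * (H z * \<Delta> z)"
      unfolding \<Delta>_inverse(2)[OF zd(2)] GY by (simp add: dims)
    finally have "\<Delta>i z * V z * T z * Y z * \<Delta>i z = (1\<^sub>m r + G z * (H z * \<Delta> z)) * \<Delta>i z"
      by simp
    also have "\<dots> = \<Delta>i z + G z * H z"
      by (simp add: mat_assoc mat_distrib dims \<Delta>_inverse(1)[OF zd(2)])
    finally have eq: "\<Delta>i z * V z * T z * Y z * \<Delta>i z = \<Delta>i z + G z * H z" .
    show "\<Delta>i z $$ (i,j) - (\<Delta>i z * V z * T z * Y z * \<Delta>i z) $$ (i,j) = ?N z $$ (i,j)"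
      unfolding eq using ij GH by (simp add: index_add_mat(1)[of i "G z * H z" j] del: index_mult_mat)
  qed (fact d(1))
qed

lemma canonical_biorth_represents:
  assumes canon: "right_canonical \<Omega> T z0 n r ms Y" and bio: "biorth T z0 r ms V Y"
  obtains H d where "represents Y H d"
proof -
  have Y: "hol_mat \<Omega> n r Y"
    and root: "\<And>i. i < r \<Longrightarrow> root_fun \<Omega> T z0 n (\<lambda>z. col (Y z) i)"
    and inj: "\<And>c. c \<in> carrier_vec r \<Longrightarrow> Y z0 *\<^sub>v c = 0\<^sub>v n \<Longrightarrow> c = 0\<^sub>v r"
    and sums: "(\<Sum>i<r. root_mult T z0 n (\<lambda>z. col (Y z) i)) = (\<Sum>i<r. ms ! i)"
    and le: "\<And>i j. i \<le> j \<Longrightarrow> j < r \<Longrightarrow>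
      root_mult T z0 n (\<lambda>z. col (Y z) j) \<le> root_mult T z0 n (\<lambda>z. col (Y z) i)"
    using canon unfolding right_canonical_def by blast+
  have z0: "z0 \<in> \<Omega>" using ball_subset e_pos by auto
  have "vec_zero_order_is z0 n (\<lambda>z. T z *\<^sub>v col (Y z) i) (ms ! i)" if "i < r" for i
  proof (rule canonical_orders[where d = e and B = "Y z0" and r = r and y = "\<lambda>i z. col (Y z) i"])
    show "hol_vec (ball z0 e) n (\<lambda>z. col (Y z) i)" if "i < r" for i
      using root[OF that] ball_subset by (auto simp: root_fun_def elim: hol_vec_subset)
    show "col (Y z0) i \<noteq> 0\<^sub>v n" if "i < r" for i
      using root[OF that] by (simp add: root_fun_def)
    show "Y z0 \<in> carrier_mat n r" by (rule hol_mat_carrier[OF Y z0])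
  qed (use desc len r_le e_pos inj sums le that in \<open>auto simp: root_mult_def\<close>)
  then have "\<exists>d'>0. \<exists>g. hol_vec (ball z0 d') n g \<and>
      (\<forall>z\<in>ball z0 d'. T z *\<^sub>v col (Y z) i = (z - z0) ^ (ms ! i) \<cdot>\<^sub>v g z)" if "i < r" for i
    using that unfolding vec_zero_order_is_def by blast
  then obtain \<delta> and g :: "nat \<Rightarrow> complex \<Rightarrow> complex Matrix.vec" where g:
    "\<And>i. i < r \<Longrightarrow> 0 < \<delta> i" "\<And>i. i < r \<Longrightarrow> hol_vec (ball z0 (\<delta> i)) n (g i)"
    "\<And>i z. i < r \<Longrightarrow> z \<in> ball z0 (\<delta> i) \<Longrightarrow>
      T z *\<^sub>v col (Y z) i = (z - z0) ^ (ms ! i) \<cdot>\<^sub>v g i z"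
    by metis
  obtain b N where b: "0 < b" and N: "hol_mat (ball z0 b) r r N"
    and N_eq: "\<And>z i j. z \<in> ball z0 b - {z0} \<Longrightarrow> i < r \<Longrightarrow> j < r \<Longrightarrow>
      \<Delta>i z $$ (i,j) - (\<Delta>i z * V z * T z * Y z * \<Delta>i z) $$ (i,j) = N z $$ (i,j)"
    using bio unfolding biorth_def mero_eq_def by blast
  define d where "d = Min ({b, e} \<union> \<delta> ` {..<r})"
  have d: "0 < d" "d \<le> b" "d \<le> e" "\<And>i. i < r \<Longrightarrow> d \<le> \<delta> i"
    unfolding d_def using b e_pos g(1) by (auto intro!: Min_le simp del: Min_insert)
  have sub: "ball z0 d \<subseteq> ball z0 b" "ball z0 d \<subseteq> ball z0 e" "\<And>i. i < r \<Longrightarrow> ball z0 d \<subseteq> ball z0 (\<delta> i)"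
    using d by (simp_all add: subset_ball)
  define Q where "Q z = Matrix.mat n r (\<lambda>(i,j). g j z $ i)" for z
  have Qc: "Q z \<in> carrier_mat n r" for z by (simp add: Q_def)
  have hol_Q: "hol_mat (ball z0 d) n r Q"
    unfolding Q_def by (intro hol_mat_mat hol_vec_index[OF hol_vec_subset[OF g(2) sub(3)]])
  \<comment> \<open>Read off from Y = T^-1 (T Y): \<open>K\<close> meets T Y = Q Delta, and
    \<open>Y\<^sub>0\<close> meets the biorthogonality defect \<open>N\<close>.\<close>
  define H where "H z = K z * Q z - Y\<^sub>0 z * N z" for z
  have hol_H: "hol_mat (ball z0 d) n r H"
    unfolding H_def
    by (intro hol_mat_minus hol_mat_mult[OF hol_mat_subset[OF hol_K sub(2)] hol_Q]
        hol_mat_mult[OF hol_mat_subset[OF hol_Y\<^sub>0 sub(2)] hol_mat_subset[OF N sub(1)]])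
  have off: "Y z = Y\<^sub>0 z + H z * \<Delta> z" if z: "z \<in> ball z0 d - {z0}" for z
  proof -
    have zb: "z \<in> ball z0 b" "z \<in> ball z0 e" "z \<in> ball z0 d" "z \<noteq> z0" using z sub by auto
    have Yc: "Y z \<in> carrier_mat n r" using hol_mat_carrier[OF Y] zb ball_subset by auto
    have Nc: "N z \<in> carrier_mat r r" by (rule hol_mat_carrier[OF N zb(1)])
    note c = carrier[OF zb(2)] V_carrier[OF zb(2)] Yc Nc Qc[of z]
    note dims = c[THEN carrier_matD(1)] c[THEN carrier_matD(2)]
    have TY: "T z * Y z = Q z * \<Delta> z"
    proof (rule eq_matI)
      fix i j assume "i < dim_row (Q z * \<Delta> z)" "j < dim_col (Q z * \<Delta> z)"
      then have ij: "i < n" "j < r" by (auto simp: Q_def Delta_def mat_diag_def)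
      have "(T z * Y z) $$ (i,j) = (T z *\<^sub>v col (Y z) j) $ i"
        using c ij by simp
      also have "\<dots> = (z - z0) ^ (ms ! j) * g j z $ i"
        using g(3)[OF ij(2)] sub(3)[OF ij(2)] zb ij hol_vec_carrier[OF g(2)[OF ij(2)], of z] by auto
      also have "\<dots> = (Q z * \<Delta> z) $$ (i,j)"
        unfolding mult_\<Delta>[OF Qc] using ij by (simp add: Q_def)
      finally show "(T z * Y z) $$ (i,j) = (Q z * \<Delta> z) $$ (i,j)" .
    qed (use c in \<open>auto simp: Delta_def mat_diag_def\<close>)
    define X where "X = \<Delta>i z * V z * T z * Y z"
    have X: "X \<in> carrier_mat r r"
      by (rule carrier_matI) (simp_all add: X_def dims)
    have XD: "X * \<Delta>i z = \<Delta>i z - N z"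
    proof (rule eq_matI)
      fix i j assume "i < dim_row (\<Delta>i z - N z)" "j < dim_col (\<Delta>i z - N z)"
      then have ij: "i < r" "j < r" using Nc by auto
      have "\<Delta>i z $$ (i,j) - (X * \<Delta>i z) $$ (i,j) = N z $$ (i,j)"
        unfolding X_def by (rule N_eq[OF _ ij]) (use zb in auto)
      then have "(X * \<Delta>i z) $$ (i,j) = \<Delta>i z $$ (i,j) - N z $$ (i,j)"
        by (metis diff_diff_eq2 add_diff_cancel_left')
      then show "(X * \<Delta>i z) $$ (i,j) = (\<Delta>i z - N z) $$ (i,j)"
        using ij Nc by simp
    qed (use X Nc in \<open>auto simp: Delta_inv_def mat_diag_def\<close>)
    \<comment> \<open>Multiplying the biorthogonality relation by Delta on the right removes both
      poles: X = 1 - N Delta.\<close>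
    have "X = X * (\<Delta>i z * \<Delta> z)" using X by (simp add: \<Delta>_inverse(2)[OF zb(4)])
    also have "\<dots> = (\<Delta>i z - N z) * \<Delta> z"
      using X by (simp flip: XD add: mat_assoc)
    also have "\<dots> = 1\<^sub>m r - N z * \<Delta> z"
      by (simp add: mat_distrib dims \<Delta>_inverse(2)[OF zb(4)])
    finally have X_eq: "X = 1\<^sub>m r - N z * \<Delta> z" .
    have "Y z = ((Y\<^sub>0 z * \<Delta>i z * V z + K z) * T z) * Y z"
      using Yc by (simp add: inverse_T(2)[OF zb(2,4)])
    also have "\<dots> = Y\<^sub>0 z * X + K z * (T z * Y z)"
      by (simp add: X_def mat_assoc mat_distrib dims)
    also have "Y\<^sub>0 z * X = Y\<^sub>0 z - Y\<^sub>0 z * (N z * \<Delta> z)"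
      by (simp add: X_eq mat_distrib dims)
    finally have Y1: "Y z = Y\<^sub>0 z - Y\<^sub>0 z * (N z * \<Delta> z) + K z * (Q z * \<Delta> z)"
      by (simp add: TY)
    have H1: "H z * \<Delta> z = K z * (Q z * \<Delta> z) - Y\<^sub>0 z * (N z * \<Delta> z)"
      by (simp add: H_def mat_distrib mat_assoc dims)
    have comm: "P - M + N = P + (N - M)"
      if "dim_row M = dim_row P" "dim_col M = dim_col P" "dim_row N = dim_row P" "dim_col N = dim_col P"
      for P M N :: "complex mat"
      using that by (intro eq_matI) auto
    show ?thesis
      unfolding H1 Y1 by (intro comm) (simp_all add: dims)
  qed
  have "Y z = Y\<^sub>0 z + H z * \<Delta> z" if "z \<in> ball z0 d" for z
  proof (rule hol_mat_eq_center[OF _ _ d(1) off that])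
    show "hol_mat (ball z0 d) n r Y"
      using Y sub(2) ball_subset by (meson hol_mat_subset)
    show "hol_mat (ball z0 d) n r (\<lambda>z. Y\<^sub>0 z + H z * \<Delta> z)"
      by (intro hol_mat_add hol_mat_mult[OF hol_H hol_\<Delta>] hol_mat_subset[OF hol_Y\<^sub>0 sub(2)])
  qed
  then show thesis
    using that hol_H d unfolding represents_def by blast
qed

text \<open>Column j of \<open>Y\<^sub>0\<close> is cut at order m_j, so that the discarded tail is
  divisible by the j-th diagonal entry of Delta and can be absorbed, with a minus sign, into H. The
  retained part is entire, whence the arbitrary domain \<open>S\<close>.\<close>

lemma represents_exists:
  obtains Y H where "hol_mat S n r Y" "represents Y H e"
proof -
  have "\<exists>p h. p holomorphic_on UNIV \<and> h holomorphic_on ball z0 e \<and>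
      (\<forall>z\<in>ball z0 e. Y\<^sub>0 z $$ (i,j) = p z + (z - z0) ^ (ms ! j) * h z)" if "i < n" "j < r" for i j
    using holomorphic_taylor_remainder[OF hol_mat_index[OF hol_Y\<^sub>0 that] open_ball, of z0 "ms ! j"] by metis
  then obtain p h where ph: "\<And>i j. i < n \<Longrightarrow> j < r \<Longrightarrow> p i j holomorphic_on UNIV"
    "\<And>i j. i < n \<Longrightarrow> j < r \<Longrightarrow> h i j holomorphic_on ball z0 e"
    "\<And>i j z. i < n \<Longrightarrow> j < r \<Longrightarrow> z \<in> ball z0 e \<Longrightarrow>
      Y\<^sub>0 z $$ (i,j) = p i j z + (z - z0) ^ (ms ! j) * h i j z"
    by metis
  show thesis
  proof (rule that)
    show "hol_mat S n r (\<lambda>z. Matrix.mat n r (\<lambda>(i,j). p i j z))"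
      by (intro hol_mat_mat holomorphic_on_subset[OF ph(1)]) auto
    show "represents (\<lambda>z. Matrix.mat n r (\<lambda>(i,j). p i j z)) (\<lambda>z. Matrix.mat n r (\<lambda>(i,j). - h i j z)) e"
      unfolding represents_def
    proof (intro conjI ballI)
      show "hol_mat (ball z0 e) n r (\<lambda>z. Matrix.mat n r (\<lambda>(i,j). - h i j z))"
        by (intro hol_mat_mat holomorphic_intros ph)
      fix z assume z: "z \<in> ball z0 e"
      let ?H = "Matrix.mat n r (\<lambda>(i,j). - h i j z)"
      show "Matrix.mat n r (\<lambda>(i,j). p i j z) = Y\<^sub>0 z + ?H * \<Delta> z"
        by (subst mult_\<Delta>[of _ n]) (auto intro!: eq_matI simp: ph(3)[OF _ _ z])
    qed (use e_pos in auto)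
  qed
qed

text \<open>Two representable matrices differ near \<open>z0\<close> by (H' - H) Delta. Dividing
  column j by its power of z - z0 extends this quotient to all of \<Omega>, by
  \<open>holomorphic_factor_extend\<close>. Conversely, a global correction is simply added to the
  local one.\<close>

lemma represents_iff_shift:
  assumes Y: "hol_mat \<Omega> n r Y" and rep: "represents Y H d"
  shows "(hol_mat \<Omega> n r Y' \<and> (\<exists>H' d'. represents Y' H' d')) \<longleftrightarrow>
    (\<exists>J. hol_mat \<Omega> n r J \<and> (\<forall>z\<in>\<Omega>. Y' z = Y z + J z * \<Delta> z))"
proof
  have d: "0 < d" "d \<le> e" "ball z0 d \<subseteq> \<Omega>" and H: "hol_mat (ball z0 d) n r H"
    and Y_eq: "\<And>z. z \<in> ball z0 d \<Longrightarrow> Y z = Y\<^sub>0 z + H z * \<Delta> z"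
    using rep ball_subset by (auto simp: represents_def)
  {
    assume "hol_mat \<Omega> n r Y' \<and> (\<exists>H' d'. represents Y' H' d')"
    then obtain H' d' where Y': "hol_mat \<Omega> n r Y'" and d': "0 < d'"
      and H': "hol_mat (ball z0 d') n r H'"
      and Y'_eq: "\<And>z. z \<in> ball z0 d' \<Longrightarrow> Y' z = Y\<^sub>0 z + H' z * \<Delta> z"
      by (auto simp: represents_def)
    define m where "m = min d d'"
    have m: "0 < m" "ball z0 m \<subseteq> ball z0 d" "ball z0 m \<subseteq> ball z0 d'"
      using d d' by (auto simp: m_def)
    have "\<exists>J. J holomorphic_on \<Omega> \<and>
        (\<forall>z\<in>\<Omega>. Y' z $$ (i,j) - Y z $$ (i,j) = (z - z0) ^ (ms ! j) * J z)" if ij: "i < n" "j < r" for i j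
    proof -
      have f1: "(\<lambda>z. Y' z $$ (i,j) - Y z $$ (i,j)) holomorphic_on \<Omega>"
        by (intro holomorphic_intros hol_mat_index[OF Y' ij] hol_mat_index[OF Y ij])
      have f2: "(\<lambda>z. H' z $$ (i,j) - H z $$ (i,j)) holomorphic_on ball z0 m"
        using hol_mat_index[OF hol_mat_subset[OF H' m(3)] ij] hol_mat_index[OF hol_mat_subset[OF H m(2)] ij]
        by (intro holomorphic_intros)
      have f3: "Y' z $$ (i,j) - Y z $$ (i,j) = (z - z0) ^ (ms ! j) * (H' z $$ (i,j) - H z $$ (i,j))"
        if z: "z \<in> ball z0 m" for z
      proof -
        have zz: "z \<in> ball z0 d" "z \<in> ball z0 d'" using z m by auto
        note c = hol_mat_carrier[OF H zz(1)] hol_mat_carrier[OF H' zz(2)]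
        show ?thesis
          unfolding Y_eq[OF zz(1)] Y'_eq[OF zz(2)] mult_\<Delta>[OF c(1)] mult_\<Delta>[OF c(2)]
          using ij by (simp add: algebra_simps)
      qed
      show ?thesis
        by (rule holomorphic_factor_extend[OF f1 open_\<Omega> m(1) f2 f3]) (assumption, blast)
    qed
    then obtain J where J: "\<And>i j. i < n \<Longrightarrow> j < r \<Longrightarrow> J i j holomorphic_on \<Omega>"
      "\<And>i j z. i < n \<Longrightarrow> j < r \<Longrightarrow> z \<in> \<Omega> \<Longrightarrow>
        Y' z $$ (i,j) - Y z $$ (i,j) = (z - z0) ^ (ms ! j) * J i j z"
      by metis
    show "\<exists>J. hol_mat \<Omega> n r J \<and> (\<forall>z\<in>\<Omega>. Y' z = Y z + J z * \<Delta> z)"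
    proof (intro exI conjI ballI)
      let ?J = "\<lambda>z. Matrix.mat n r (\<lambda>(i,j). J i j z)"
      show "hol_mat \<Omega> n r ?J" by (intro hol_mat_mat J)
      fix z assume z: "z \<in> \<Omega>"
      have JD: "?J z * \<Delta> z = Matrix.mat n r (\<lambda>(i,j). Y' z $$ (i,j) - Y z $$ (i,j))"
        by (subst mult_\<Delta>[of _ n]) (auto intro!: eq_matI simp: J(2)[OF _ _ z])
      show "Y' z = Y z + ?J z * \<Delta> z"
        unfolding JD using hol_mat_carrier[OF Y z] hol_mat_carrier[OF Y' z] by (intro eq_matI) auto
    qed
  }
  {
    assume "\<exists>J. hol_mat \<Omega> n r J \<and> (\<forall>z\<in>\<Omega>. Y' z = Y z + J z * \<Delta> z)"
    then obtain J where J: "hol_mat \<Omega> n r J" and Y': "\<And>z. z \<in> \<Omega> \<Longrightarrow> Y' z = Y z + J z * \<Delta> z"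
      by blast
    have "hol_mat \<Omega> n r Y'"
      by (rule hol_mat_cong[OF hol_mat_add[OF Y hol_mat_mult[OF J hol_\<Delta>]]]) (simp add: Y')
    moreover have "represents Y' (\<lambda>z. H z + J z) d"
      unfolding represents_def
    proof (intro conjI ballI)
      show "hol_mat (ball z0 d) n r (\<lambda>z. H z + J z)"
        by (intro hol_mat_add H hol_mat_subset[OF J d(3)])
      fix z assume z: "z \<in> ball z0 d"
      then have z\<Omega>: "z \<in> \<Omega>" using d by auto
      note c = hol_mat_carrier[OF H z] hol_mat_carrier[OF J z\<Omega>]
      show "Y' z = Y\<^sub>0 z + (H z + J z) * \<Delta> z"
        unfolding Y'[OF z\<Omega>] Y_eq[OF z] using c
        by (simp add: mat_distrib assoc_add_mat[of _ n r] mult_carrier_mat[of _ n r _ r])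
    qed (use d in auto)
    ultimately show "hol_mat \<Omega> n r Y' \<and> (\<exists>H' d'. represents Y' H' d')" by blast
  }
qed

text \<open>Off \<open>z0\<close> the Delta of the correction cancels against Delta^-1, so Y
  Delta^-1 V exceeds Y0 Delta^-1 V by H V; subtracting T^-1 leaves H V - K.\<close>

lemma represents_inverse:
  assumes "represents Y H d"
  shows "mero_eq z0 n n (\<lambda>z. minv n (T z)) (\<lambda>z. Y z * \<Delta>i z * V z)"
  unfolding mero_eq_def
proof (intro exI conjI ballI allI impI)
  have d: "0 < d" "ball z0 d \<subseteq> ball z0 e" and H: "hol_mat (ball z0 d) n r H"
    and Y_eq: "\<And>z. z \<in> ball z0 d \<Longrightarrow> Y z = Y\<^sub>0 z + H z * \<Delta> z"
    using assms by (auto simp: represents_def)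
  show "0 < d" by (fact d(1))
  show "hol_mat (ball z0 d) n n (\<lambda>z. H z * V z - K z)"
    by (intro hol_mat_minus hol_mat_mult[OF H hol_mat_subset[OF hol_V d(2)]] hol_mat_subset[OF hol_K d(2)])
  fix z i j assume z: "z \<in> ball z0 d - {z0}" and ij: "i < n" "j < n"
  then have zd: "z \<in> ball z0 d" "z \<in> ball z0 e" "z \<noteq> z0" using d by auto
  note c = V_carrier[OF zd(2)] hol_mat_carrier[OF H zd(1)]
  note dims = c[THEN carrier_matD(1)] c[THEN carrier_matD(2)]
  have "Y z * \<Delta>i z = Y\<^sub>0 z * \<Delta>i z + H z"
    by (simp add: Y_eq[OF zd(1)] mat_distrib mat_assoc dims \<Delta>_inverse[OF zd(3)])
  then have "Y z * \<Delta>i z * V z = Y\<^sub>0 z * \<Delta>i z * V z + H z * V z"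
    by (simp add: mat_distrib dims)
  moreover have "Y\<^sub>0 z * \<Delta>i z * V z \<in> carrier_mat n n" "H z * V z \<in> carrier_mat n n"
    using c by (auto intro!: mult_carrier_mat[of _ n r _ n] mult_carrier_mat[of _ n r _ r])
  ultimately show "(Y z * \<Delta>i z * V z) $$ (i,j) - minv n (T z) $$ (i,j) = (H z * V z - K z) $$ (i,j)"
    using ij unfolding minv_T[OF zd(2,3)]
    by (simp add: dims del: index_mult_mat(1))
qed

end

section \<open>Existence, uniqueness and the inverse formula combined\<close>

theorem mainTheorem3:
  fixes \<Omega> :: "complex set" and z0 :: complex and T V :: "complex \<Rightarrow> complex mat"
    and n :: nat and ms :: "nat list"
  assumes "open \<Omega>" and "z0 \<in> \<Omega>"
    and "hol_mat \<Omega> n n T"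
    and "\<not> (\<forall>z\<in>\<Omega>. Determinant.det (T z) = 0)"
    and "Determinant.det (T z0) = 0"
    and "partial_mults \<Omega> T z0 n ms"
    and "left_canonical \<Omega> T z0 n (kernel_dim (T z0)) ms V"
  shows "(\<exists>Y. right_canonical \<Omega> T z0 n (kernel_dim (T z0)) ms Y \<and>
              biorth T z0 (kernel_dim (T z0)) ms V Y \<and>
              (\<forall>Y'. (right_canonical \<Omega> T z0 n (kernel_dim (T z0)) ms Y' \<and>
                      biorth T z0 (kernel_dim (T z0)) ms V Y') \<longleftrightarrow>
                     (\<exists>H. hol_mat \<Omega> n (kernel_dim (T z0)) H \<and>
                          (\<forall>z\<in>\<Omega>. Y' z = Y z + H z * Delta z0 (kernel_dim (T z0)) ms z))))
         \<and> (\<forall>Y. right_canonical \<Omega> T z0 n (kernel_dim (T z0)) ms Y \<and>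
                 biorth T z0 (kernel_dim (T z0)) ms V Y \<longrightarrow>
                 mero_eq z0 n n (\<lambda>z. minv n (T z))
                   (\<lambda>z. Y z * Delta_inv z0 (kernel_dim (T z0)) ms z * V z))"
proof -
  define r where "r = kernel_dim (T z0)"
  have ms: "length ms = n" "sorted_wrt (\<ge>) ms"
    using assms(6) by (auto simp: partial_mults_def)
  obtain e L L' R R' where S: "local_smith z0 e n T ms L L' R R'" and e: "ball z0 e \<subseteq> \<Omega>"
    using partial_mults_local_smith[OF assms(6,3)] by blast
  interpret S: local_smith z0 e n T ms L L' R R' by (rule S)
  have r: "r \<le> n" "\<And>i. i < n \<Longrightarrow> 0 < ms ! i \<longleftrightarrow> i < r"
    unfolding r_def using S.positive_mults_iff[OF ms(2,1)] by auto
  have V: "hol_mat \<Omega> r n V"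
    and root: "\<And>i. i < r \<Longrightarrow> left_root_fun \<Omega> T z0 n (\<lambda>z. Matrix.row (V z) i)"
    and inj: "\<And>c. c \<in> carrier_vec r \<Longrightarrow> transpose_mat (V z0) *\<^sub>v c = 0\<^sub>v n \<Longrightarrow> c = 0\<^sub>v r"
    and sums: "(\<Sum>i<r. left_root_mult T z0 n (\<lambda>z. Matrix.row (V z) i)) = (\<Sum>i<r. ms ! i)"
    and le: "\<And>i j. i \<le> j \<Longrightarrow> j < r \<Longrightarrow>
      left_root_mult T z0 n (\<lambda>z. Matrix.row (V z) j) \<le> left_root_mult T z0 n (\<lambda>z. Matrix.row (V z) i)"
    using assms(7) unfolding left_canonical_def r_def by blast+
  have V0: "V z0 \<in> carrier_mat r n" by (rule hol_mat_carrier[OF V assms(2)])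
  have V_e: "hol_mat (ball z0 e) r n V" by (rule hol_mat_subset[OF V e])
  \<comment> \<open>A left root function of T is a right root function of the transpose, whose Smith
    factorization has the same multiplicities.\<close>
  have ord: "vec_zero_order_is z0 n (\<lambda>z. transpose_mat (T z) *\<^sub>v Matrix.row (V z) i) (ms ! i)" if "i < r" for i
  proof (rule local_smith.canonical_orders[OF S.transpose, where d = e and
        B = "transpose_mat (V z0)" and r = r and y = "\<lambda>i z. Matrix.row (V z) i"])
    show "hol_vec (ball z0 e) n (\<lambda>z. Matrix.row (V z) i)" if "i < r" for i
      using root[OF that] e by (auto simp: left_root_fun_def elim: hol_vec_subset)
    show "Matrix.row (V z0) i \<noteq> 0\<^sub>v n" if "i < r" for i
      using root[OF that] by (simp add: left_root_fun_def)
  qed (use ms r S.e_pos V0 inj sums le that in \<open>auto simp: left_root_mult_def\<close>)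
  obtain e2 L2 L2' R2 R2' where S2: "local_smith z0 e2 n T ms L2 L2' R2 R2'" and e2: "e2 \<le> e"
    and rows: "\<forall>z\<in>ball z0 e2. \<forall>i<r. \<forall>j<n. L2' z $$ (i,j) = V z $$ (i,j)"
    by (rule S.adapt_rows[OF r S.e_pos V_e inj ord])
  have e2_sub: "ball z0 e2 \<subseteq> ball z0 e" using e2 by (rule subset_ball)
  interpret S2: local_smith z0 e2 n T ms L2 L2' R2 R2' by (rule S2)
  interpret A: adapted_smith z0 e2 n T ms L2 L2' R2 R2' \<Omega> V r
    by unfold_locales (use assms(1) e2_sub e hol_mat_subset[OF V_e e2_sub] r ms rows in auto)
  \<comment> \<open>This equivalence turns each of the claims into a statement about
    \<open>A.represents\<close>.\<close>
  have canon_iff: "right_canonical \<Omega> T z0 n r ms Y \<and> biorth T z0 r ms V Y \<longleftrightarrow>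
      hol_mat \<Omega> n r Y \<and> (\<exists>H d. A.represents Y H d)" for Y
  proof
    assume Y: "right_canonical \<Omega> T z0 n r ms Y \<and> biorth T z0 r ms V Y"
    then obtain H d where "A.represents Y H d"
      by (elim conjE A.canonical_biorth_represents)
    with Y show "hol_mat \<Omega> n r Y \<and> (\<exists>H d. A.represents Y H d)"
      by (auto simp: right_canonical_def)
  qed (auto dest: A.represents_canonical_biorth)
  obtain Y H where Y: "hol_mat \<Omega> n r Y" "A.represents Y H e2"
    using A.represents_exists by blast
  show ?thesis
    unfolding r_def[symmetric]
  proof (intro conjI exI allI impI)
    show "right_canonical \<Omega> T z0 n r ms Y" "biorth T z0 r ms V Y"
      using A.represents_canonical_biorth[OF Y] by auto
    show "right_canonical \<Omega> T z0 n r ms Y' \<and> biorth T z0 r ms V Y' \<longleftrightarrow>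
        (\<exists>H. hol_mat \<Omega> n r H \<and> (\<forall>z\<in>\<Omega>. Y' z = Y z + H z * Delta z0 r ms z))" for Y'
      unfolding canon_iff by (rule A.represents_iff_shift[OF Y])
    show "mero_eq z0 n n (\<lambda>z. minv n (T z)) (\<lambda>z. Y z * Delta_inv z0 r ms z * V z)"
      if "right_canonical \<Omega> T z0 n r ms Y \<and> biorth T z0 r ms V Y" for Y
      using that canon_iff A.represents_inverse by blast
  qed
qed

end
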